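(* Let $\pi$ be a probability distribution on $\{0,1,2,\dots\}$ with mean $1$. The $F$-probability of the unimodular (ordered) Eternal Galton-Watson Tree $EGWT(\pi)$, where $F$ is the parent vertex-shift, is the (ordered) Eternal Kesten Tree $EKT(\pi)$. That is, if $[\mathbf{T},\mathbf{o}]\sim EGWT(\pi)$, then $[\mathbf{T},F^n(\mathbf{o})]$ converges in distribution to $EKT(\pi)$ as $n\to\infty$, both as unordered and as ordered rooted Family Trees.
   Context: **Family Trees.** A Family Tree is a locally finite directed tree in which each vertex has out-degree at most $1$; $F(v)$ is the parent of $v$ (endpoint of its outgoing edge). It is eternal if each vertex has a parent, ordered if the children of each vertex are totally ordered. Rooted (ordered) Family Trees are considered up to isomorphism, with the local topology (convergence means that balls of each radius around the root are eventually isomorphic). Write $\hat\pi(k)=k\pi(k)$. **$EGWT(\pi)$.** The random rooted ordered Eternal Family Tree $[\mathbf{T},\mathbf{o}]$ such that: the ancestors $F^n(\mathbf{o})$, $n\ge1$, have offspring distribution $\hat\pi$ (one child of $F^n(\mathbf{o})$ being $F^{n-1}(\mathbf{o})$, with $F^0(\mathbf{o})=\mathbf{o}$); all other vertices, including $\mathbf{o}$, have offspring distribution $\pi$; all vertices reproduce independently; the order among the children of every vertex is uniform. **$EKT(\pi)$.** The random rooted ordered Eternal Family Tree with a bi-infinite directed path $(\mathbf{o}_n)_{n\in\mathbb{Z}}$, $F(\mathbf{o}_{n-1})=\mathbf{o}_n$, rooted at $\mathbf{o}_0$, where each $\mathbf{o}_n$, $n\in\mathbb{Z}$, has offspring distribution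 $\hat\pi$ (one of the children being $\mathbf{o}_{n-1}$), all other vertices have offspring distribution $\pi$, all vertices reproduce independently, and the order among the children of every vertex is uniform. *)

theory Defs
  imports "HOL-Probability.Probability" "HOL-Combinatorics.Multiset_Permutations"
begin

text \<open>An arc \<open>(u, v)\<close> points from \<open>u\<close> to its parent \<open>v\<close>. In an ordered tree, \<open>(x, y) \<in> sib T\<close>
  means that \<open>x\<close> and \<open>y\<close> are siblings and \<open>x\<close> comes strictly before \<open>y\<close>.\<close>

record 'v rooted_tree =
  verts :: "'v set"
  arcs :: "('v \<times> 'v) set"
  origin :: 'v

record 'v ordered_tree = "'v rooted_tree" +
  sib :: "('v \<times> 'v) set"

definition adj :: "('v, 'b) rooted_tree_scheme \<Rightarrow> ('v \<times> 'v) set" where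
  "adj T = arcs T \<union> (arcs T)\<inverse>"

definition children :: "('v, 'b) rooted_tree_scheme \<Rightarrow> 'v \<Rightarrow> 'v set" where
  "children T v = {u. (u, v) \<in> arcs T}"

text \<open>The last condition says that the underlying undirected graph has no cycle: an undirected
  cycle is an edge together with a walk between its end points that avoids this edge. It also
  excludes loops and pairs of opposite arcs.\<close>

definition family_tree :: "('v, 'b) rooted_tree_scheme \<Rightarrow> bool" where
  "family_tree T \<longleftrightarrow>
     origin T \<in> verts T \<and>
     arcs T \<subseteq> verts T \<times> verts T \<and>
     single_valued (arcs T) \<and>
     (\<forall>v\<in>verts T. finite {u. (u, v) \<in> adj T}) \<and>
     (\<forall>u\<in>verts T. \<forall>v\<in>verts T. (u, v) \<in> (adj T)\<^sup>*) \<and>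
     (\<forall>(u, v)\<in>arcs T. (u, v) \<notin> (adj T - {(u, v), (v, u)})\<^sup>*)"

definition ordered_family_tree :: "'v ordered_tree \<Rightarrow> bool" where
  "ordered_family_tree T \<longleftrightarrow>
     family_tree T \<and>
     sib T \<subseteq> (\<Union>v\<in>verts T. children T v \<times> children T v) \<and>
     (\<forall>v\<in>verts T. strict_linear_order_on (children T v) (Restr (sib T) (children T v)))"

definition is_iso ::
    "('v \<Rightarrow> 'w) \<Rightarrow> ('v, 'b) rooted_tree_scheme \<Rightarrow> ('w, 'c) rooted_tree_scheme \<Rightarrow> bool" where
  "is_iso f T T' \<longleftrightarrow>
     bij_betw f (verts T) (verts T') \<and> f (origin T) = origin T' \<and>
     (\<forall>u\<in>verts T. \<forall>v\<in>verts T. (u, v) \<in> arcs T \<longleftrightarrow> (f u, f v) \<in> arcs T')"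

definition is_ordered_iso :: "('v \<Rightarrow> 'w) \<Rightarrow> 'v ordered_tree \<Rightarrow> 'w ordered_tree \<Rightarrow> bool" where
  "is_ordered_iso f T T' \<longleftrightarrow>
     is_iso f T T' \<and>
     (\<forall>u\<in>verts T. \<forall>v\<in>verts T. (u, v) \<in> sib T \<longleftrightarrow> (f u, f v) \<in> sib T')"

text \<open>Balls for the graph distance of the underlying undirected graph.\<close>

definition ball_verts :: "nat \<Rightarrow> ('v, 'b) rooted_tree_scheme \<Rightarrow> 'v set" where
  "ball_verts r T = {v. \<exists>k\<le>r. (origin T, v) \<in> adj T ^^ k}"

definition tree_ball :: "nat \<Rightarrow> ('v, 'b) rooted_tree_scheme \<Rightarrow> ('v, 'b) rooted_tree_scheme" where
  "tree_ball r T = T\<lparr>verts := ball_verts r T, arcs := Restr (arcs T) (ball_verts r T)\<rparr>"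

definition ordered_ball :: "nat \<Rightarrow> 'v ordered_tree \<Rightarrow> 'v ordered_tree" where
  "ordered_ball r T = (tree_ball r T)\<lparr>sib := Restr (sib T) (ball_verts r T)\<rparr>"

text \<open>Moving the root to its parent. A root without parent is kept; this convention is
  irrelevant for eternal trees.\<close>

definition move_root :: "('v, 'b) rooted_tree_scheme \<Rightarrow> ('v, 'b) rooted_tree_scheme" where
  "move_root T = T\<lparr>origin := (if origin T \<in> Domain (arcs T)
                              then (THE p. (origin T, p) \<in> arcs T) else origin T)\<rparr>"

lemma is_iso_id: "is_iso id T T"
  by (simp add: is_iso_def)

lemma is_ordered_iso_id: "is_ordered_iso id T T"
  by (simp add: is_ordered_iso_def is_iso_id)

lemma is_iso_comp: "is_iso f T T' \<Longrightarrow> is_iso g T' T'' \<Longrightarrow> is_iso (g \<circ> f) T T''"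
  unfolding is_iso_def by (auto intro: bij_betw_trans dest: bij_betwE)

lemma is_ordered_iso_comp:
  "is_ordered_iso f T T' \<Longrightarrow> is_ordered_iso g T' T'' \<Longrightarrow> is_ordered_iso (g \<circ> f) T T''"
  unfolding is_ordered_iso_def
  by (auto intro: is_iso_comp) (auto simp: is_iso_def dest: bij_betwE)

lemma inv_into_bij:
  assumes "bij_betw f A B" "u \<in> B"
  shows "inv_into A f u \<in> A" "f (inv_into A f u) = u"
  using assms by (auto simp: bij_betw_def inv_into_into f_inv_into_f)

lemma is_iso_inv:
  assumes "is_iso f T T'" "origin T \<in> verts T"
  shows "is_iso (inv_into (verts T) f) T' T"
proof -
  have b: "bij_betw f (verts T) (verts T')" using assms by (simp add: is_iso_def)
  have "inv_into (verts T) f (origin T') = origin T"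
    using assms b by (metis bij_betw_inv_into_left is_iso_def)
  then show ?thesis
    using assms b inv_into_bij[OF b] by (auto simp: is_iso_def intro: bij_betw_inv_into)
qed

lemma is_ordered_iso_inv:
  assumes "is_ordered_iso f T T'" "origin T \<in> verts T"
  shows "is_ordered_iso (inv_into (verts T) f) T' T"
proof -
  have b: "bij_betw f (verts T) (verts T')"
    using assms by (simp add: is_iso_def is_ordered_iso_def)
  show ?thesis
    using assms is_iso_inv[of f T T'] inv_into_bij[OF b] by (auto simp: is_ordered_iso_def)
qed

lemma family_treeD:
  "family_tree T \<Longrightarrow> origin T \<in> verts T"
  "family_tree T \<Longrightarrow> arcs T \<subseteq> verts T \<times> verts T"
  "family_tree T \<Longrightarrow> single_valued (arcs T)"
  by (auto simp: family_tree_def)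

lemma is_iso_ball_image:
  assumes "is_iso f T T'" "origin T \<in> verts T" "arcs T \<subseteq> verts T \<times> verts T"
  shows "(origin T, v) \<in> adj T ^^ k \<Longrightarrow> v \<in> verts T \<and> (origin T', f v) \<in> adj T' ^^ k"
proof (induction k arbitrary: v)
  case 0
  then show ?case using assms by (auto simp: is_iso_def)
next
  case (Suc k)
  then obtain u where u: "(origin T, u) \<in> adj T ^^ k" "(u, v) \<in> adj T" by auto
  have "v \<in> verts T" "u \<in> verts T" using u(2) assms(3) by (auto simp: adj_def)
  moreover have "(f u, f v) \<in> adj T'"
    using u(2) assms(1) calculation by (auto simp: adj_def is_iso_def)
  ultimately show ?case using Suc.IH[OF u(1)] by auto
qed

lemma ball_verts_subset:
  assumes "origin T \<in> verts T" "arcs T \<subseteq> verts T \<times> verts T"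
  shows "ball_verts r T \<subseteq> verts T"
  using is_iso_ball_image[OF is_iso_id assms] by (auto simp: ball_verts_def)

lemma origin_in_ball: "origin T \<in> ball_verts r T"
  unfolding ball_verts_def by (auto intro: exI[of _ 0])

lemma is_iso_ball_verts:
  assumes "is_iso f T T'"
    and T: "origin T \<in> verts T" "arcs T \<subseteq> verts T \<times> verts T"
    and T': "origin T' \<in> verts T'" "arcs T' \<subseteq> verts T' \<times> verts T'"
  shows "f ` ball_verts r T = ball_verts r T'"
proof
  show "f ` ball_verts r T \<subseteq> ball_verts r T'"
    using is_iso_ball_image[OF assms(1) T] by (auto simp: ball_verts_def)
next
  show "ball_verts r T' \<subseteq> f ` ball_verts r T"
  proof
    fix v assume v: "v \<in> ball_verts r T'"
    have b: "bij_betw f (verts T) (verts T')" using assms(1) by (simp add: is_iso_def)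
    have "v \<in> verts T'" using v ball_verts_subset[OF T'] by auto
    moreover have "inv_into (verts T) f v \<in> ball_verts r T"
      using v is_iso_ball_image[OF is_iso_inv[OF assms(1) T(1)] T'] by (auto simp: ball_verts_def)
    ultimately show "v \<in> f ` ball_verts r T"
      using inv_into_bij(2)[OF b] by (metis image_eqI)
  qed
qed

lemma is_iso_ball:
  assumes "is_iso f T T'"
    and T: "origin T \<in> verts T" "arcs T \<subseteq> verts T \<times> verts T"
    and T': "origin T' \<in> verts T'" "arcs T' \<subseteq> verts T' \<times> verts T'"
  shows "is_iso f (tree_ball r T) (tree_ball r T')"
proof -
  have img: "f ` ball_verts r T = ball_verts r T'" by (rule is_iso_ball_verts[OF assms])
  have sub: "ball_verts r T \<subseteq> verts T" by (rule ball_verts_subset[OF T])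
  have "bij_betw f (ball_verts r T) (ball_verts r T')"
    using assms(1) img sub by (auto simp: is_iso_def bij_betw_def intro: inj_on_subset)
  moreover have "f u \<in> ball_verts r T'" "u \<in> verts T" if "u \<in> ball_verts r T" for u
    using that img sub by auto
  ultimately show ?thesis using assms(1) by (simp add: is_iso_def tree_ball_def)
qed

lemma is_ordered_iso_ball:
  assumes "is_ordered_iso f T T'"
    and T: "origin T \<in> verts T" "arcs T \<subseteq> verts T \<times> verts T"
    and T': "origin T' \<in> verts T'" "arcs T' \<subseteq> verts T' \<times> verts T'"
  shows "is_ordered_iso f (ordered_ball r T) (ordered_ball r T')"
proof -
  have i: "is_iso f T T'" using assms(1) by (simp add: is_ordered_iso_def)
  have img: "f ` ball_verts r T = ball_verts r T'" by (rule is_iso_ball_verts[OF i T T'])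
  have sub: "ball_verts r T \<subseteq> verts T" by (rule ball_verts_subset[OF T])
  have "is_iso f (ordered_ball r T) (ordered_ball r T')"
    using is_iso_ball[OF i T T', of r] by (simp add: is_iso_def ordered_ball_def)
  moreover have "f u \<in> ball_verts r T'" "u \<in> verts T" if "u \<in> ball_verts r T" for u
    using that img sub by auto
  ultimately show ?thesis
    using assms(1) by (simp add: is_ordered_iso_def ordered_ball_def tree_ball_def)
qed

lemma ball_of_ball_verts:
  assumes "r \<le> s"
  shows "ball_verts r (tree_ball s T) = ball_verts r T"
proof -
  have 1: "(origin T, v) \<in> adj (tree_ball s T) ^^ k" if "(origin T, v) \<in> adj T ^^ k" "k \<le> s" for k v
    using that
  proof (induction k arbitrary: v)
    case 0
    then show ?case by simp
  next
    case (Suc k)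
    then obtain u where u: "(origin T, u) \<in> adj T ^^ k" "(u, v) \<in> adj T" by auto
    have "u \<in> ball_verts s T" "v \<in> ball_verts s T"
      using u Suc.prems unfolding ball_verts_def mem_Collect_eq by (meson Suc_leD)+
    then have "(u, v) \<in> adj (tree_ball s T)" using u(2) by (auto simp: adj_def tree_ball_def)
    then show ?case using Suc.IH[OF u(1)] Suc.prems by auto
  qed
  have 2: "(origin T, v) \<in> adj T ^^ k" if "(origin T, v) \<in> adj (tree_ball s T) ^^ k" for k v
    using that by (induction k arbitrary: v) (auto simp: adj_def tree_ball_def)
  show ?thesis
    using assms 1 2 by (auto simp: ball_verts_def) (auto simp: tree_ball_def dest: le_trans)
qed

lemma ball_verts_mono: "r \<le> s \<Longrightarrow> ball_verts r T \<subseteq> ball_verts s T"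
  unfolding ball_verts_def by (blast intro: le_trans)

lemma Restr_subset: "A \<subseteq> B \<Longrightarrow> Restr (Restr R B) A = Restr R A"
  by blast

lemma ball_of_ball: "r \<le> s \<Longrightarrow> tree_ball r (tree_ball s T) = tree_ball r T"
  using ball_of_ball_verts[of r s T] Restr_subset[OF ball_verts_mono[of r s T], of "arcs T"]
  by (simp add: tree_ball_def)

lemma ordered_ball_of_ball: "r \<le> s \<Longrightarrow> ordered_ball r (ordered_ball s T) = ordered_ball r T"
proof -
  assume "r \<le> s"
  have "ball_verts r (ordered_ball s T) = ball_verts r (tree_ball s T)"
    by (simp add: ball_verts_def ordered_ball_def adj_def)
  then show ?thesis
    using ball_of_ball_verts[OF \<open>r \<le> s\<close>, of T]
      Restr_subset[OF ball_verts_mono[OF \<open>r \<le> s\<close>, of T]]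
    by (simp add: ordered_ball_def tree_ball_def)
qed

lemma ball_wf:
  "origin (tree_ball r T) \<in> verts (tree_ball r T)"
  "arcs (tree_ball r T) \<subseteq> verts (tree_ball r T) \<times> verts (tree_ball r T)"
  using origin_in_ball[of T r] by (auto simp: tree_ball_def)

lemma ordered_ball_wf:
  "origin (ordered_ball r T) \<in> verts (ordered_ball r T)"
  "arcs (ordered_ball r T) \<subseteq> verts (ordered_ball r T) \<times> verts (ordered_ball r T)"
  using origin_in_ball[of T r] by (auto simp: tree_ball_def ordered_ball_def)

lemma is_iso_ball_mono:
  assumes "is_iso f (tree_ball s T) (tree_ball s T')" "r \<le> s"
  shows "is_iso f (tree_ball r T) (tree_ball r T')"
  using is_iso_ball[OF assms(1) ball_wf ball_wf, of r] by (simp add: ball_of_ball assms(2))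

lemma is_ordered_iso_ball_mono:
  assumes "is_ordered_iso f (ordered_ball s T) (ordered_ball s T')" "r \<le> s"
  shows "is_ordered_iso f (ordered_ball r T) (ordered_ball r T')"
  using is_ordered_iso_ball[OF assms(1) ordered_ball_wf ordered_ball_wf, of r]
  by (simp add: ordered_ball_of_ball assms(2))

lemma move_root_simps [simp]:
  "verts (move_root T) = verts T"
  "arcs (move_root T) = arcs T"
  "adj (move_root T) = adj T"
  "children (move_root T) = children T"
  by (simp_all add: move_root_def adj_def children_def fun_eq_iff)

lemma sib_move_root [simp]: "sib (move_root T) = sib T"
  by (simp add: move_root_def)

lemma move_root_iso:
  assumes "is_iso f T T'" "family_tree T" "family_tree T'"
  shows "is_iso f (move_root T) (move_root T')"
proof -
  note T = family_treeD[OF assms(2)] and T' = family_treeD[OF assms(3)]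
  have b: "bij_betw f (verts T) (verts T')" and o: "f (origin T) = origin T'"
    and a: "\<And>u v. u \<in> verts T \<Longrightarrow> v \<in> verts T \<Longrightarrow> (u, v) \<in> arcs T \<longleftrightarrow> (f u, f v) \<in> arcs T'"
    using assms(1) by (auto simp: is_iso_def)
  have "f (origin (move_root T)) = origin (move_root T')"
  proof (cases "origin T \<in> Domain (arcs T)")
    case True
    then obtain p where p: "(origin T, p) \<in> arcs T" by auto
    then have p': "(origin T', f p) \<in> arcs T'" using a T o by force
    have "(THE q. (origin T, q) \<in> arcs T) = p"
      using p T(3) by (auto simp: single_valued_def)
    moreover have "(THE q. (origin T', q) \<in> arcs T') = f p"
      using p' T'(3) by (auto simp: single_valued_def)
    ultimately show ?thesis using p p' by (auto simp: move_root_def)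
  next
    case False
    have "origin T' \<notin> Domain (arcs T')"
    proof
      assume "origin T' \<in> Domain (arcs T')"
      then obtain q where q: "(origin T', q) \<in> arcs T'" by auto
      then have "q \<in> verts T'" using T' by auto
      then obtain p where "p \<in> verts T" "q = f p" using b by (auto simp: bij_betw_def)
      then show False using False a[of "origin T" p] q o T(1) by auto
    qed
    then show ?thesis using False o by (simp add: move_root_def)
  qed
  then show ?thesis using b a by (simp add: is_iso_def)
qed

lemma move_root_family_tree:
  assumes "family_tree T"
  shows "family_tree (move_root T)"
proof -
  have "origin (move_root T) \<in> verts T"
  proof (cases "origin T \<in> Domain (arcs T)")
    case True
    then obtain p where p: "(origin T, p) \<in> arcs T" by auto
    then have "(THE q. (origin T, q) \<in> arcs T) = p"
      using family_treeD(3)[OF assms] by (auto simp: single_valued_def)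
    then show ?thesis using p family_treeD(2)[OF assms] by (auto simp: move_root_def)
  next
    case False
    then show ?thesis using family_treeD(1)[OF assms] by (simp add: move_root_def)
  qed
  then show ?thesis using assms by (simp add: family_tree_def)
qed

lemma move_root_ordered_family_tree:
  "ordered_family_tree T \<Longrightarrow> ordered_family_tree (move_root T)"
  using move_root_family_tree[of T] by (simp add: ordered_family_tree_def)

text \<open>Locally finite connected graphs are countable, so every rooted Family Tree is isomorphic to
  one with vertices in \<open>nat\<close>.\<close>

definition tree_equiv :: "nat rooted_tree \<Rightarrow> nat rooted_tree \<Rightarrow> bool" where
  "tree_equiv T T' \<longleftrightarrow> family_tree T \<and> family_tree T' \<and> (\<exists>f. is_iso f T T')"

definition ordered_tree_equiv :: "nat ordered_tree \<Rightarrow> nat ordered_tree \<Rightarrow> bool" where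
  "ordered_tree_equiv T T' \<longleftrightarrow>
     ordered_family_tree T \<and> ordered_family_tree T' \<and> (\<exists>f. is_ordered_iso f T T')"

lemma ordered_family_treeD: "ordered_family_tree T \<Longrightarrow> family_tree T"
  by (simp add: ordered_family_tree_def)

lemma ordered_family_tree_singleton:
  "ordered_family_tree \<lparr>verts = {v}, arcs = {}, origin = v, sib = {}\<rparr>"
  by (auto simp: ordered_family_tree_def family_tree_def adj_def children_def
      strict_linear_order_on_def irrefl_def trans_def)

lemma family_tree_singleton: "family_tree \<lparr>verts = {v}, arcs = {}, origin = v\<rparr>"
  by (auto simp: family_tree_def adj_def)

lemma tree_equiv_sym: "tree_equiv T T' \<Longrightarrow> tree_equiv T' T"
  unfolding tree_equiv_def by (metis is_iso_inv family_treeD(1))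

lemma tree_equiv_trans: "tree_equiv T T' \<Longrightarrow> tree_equiv T' T'' \<Longrightarrow> tree_equiv T T''"
  unfolding tree_equiv_def by (metis is_iso_comp)

lemma ordered_tree_equiv_sym: "ordered_tree_equiv T T' \<Longrightarrow> ordered_tree_equiv T' T"
  unfolding ordered_tree_equiv_def
  by (metis is_ordered_iso_inv family_treeD(1) ordered_family_treeD)

lemma ordered_tree_equiv_trans:
  "ordered_tree_equiv T T' \<Longrightarrow> ordered_tree_equiv T' T'' \<Longrightarrow> ordered_tree_equiv T T''"
  unfolding ordered_tree_equiv_def by (metis is_ordered_iso_comp)

quotient_type family_tree_class = "nat rooted_tree" / partial: tree_equiv
proof (rule part_equivpI)
  show "\<exists>T. tree_equiv T T"
    unfolding tree_equiv_def by (intro exI conjI, rule family_tree_singleton[of 0],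
        rule family_tree_singleton[of 0], rule is_iso_id)
  show "symp tree_equiv"
    by (intro sympI) (rule tree_equiv_sym)
  show "transp tree_equiv"
    by (intro transpI) (rule tree_equiv_trans)
qed

quotient_type ordered_family_tree_class = "nat ordered_tree" / partial: ordered_tree_equiv
proof (rule part_equivpI)
  show "\<exists>T. ordered_tree_equiv T T"
    unfolding ordered_tree_equiv_def by (intro exI conjI, rule ordered_family_tree_singleton[of 0],
        rule ordered_family_tree_singleton[of 0], rule is_ordered_iso_id)
  show "symp ordered_tree_equiv"
    by (intro sympI) (rule ordered_tree_equiv_sym)
  show "transp ordered_tree_equiv"
    by (intro transpI) (rule ordered_tree_equiv_trans)
qed

lift_definition parent_shift :: "family_tree_class \<Rightarrow> family_tree_class" is move_root
  unfolding tree_equiv_def by (metis move_root_iso move_root_family_tree)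

lift_definition ordered_parent_shift ::
    "ordered_family_tree_class \<Rightarrow> ordered_family_tree_class" is move_root
proof -
  fix T T' :: "nat ordered_tree"
  assume "ordered_tree_equiv T T'"
  then obtain f where T: "ordered_family_tree T" and T': "ordered_family_tree T'"
    and f: "is_ordered_iso f T T'" by (auto simp: ordered_tree_equiv_def)
  have "is_iso f (move_root T) (move_root T')"
    using move_root_iso T T' f ordered_family_treeD by (auto simp: is_ordered_iso_def)
  then have "is_ordered_iso f (move_root T) (move_root T')"
    using f by (simp add: is_ordered_iso_def)
  then show "ordered_tree_equiv (move_root T) (move_root T')"
    using T T' move_root_ordered_family_tree by (auto simp: ordered_tree_equiv_def)
qed

lift_definition forget_order :: "ordered_family_tree_class \<Rightarrow> family_tree_class"
  is rooted_tree.truncate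
  by (auto simp: ordered_tree_equiv_def tree_equiv_def ordered_family_tree_def family_tree_def
      adj_def is_ordered_iso_def is_iso_def rooted_tree.truncate_def)

lift_definition same_ball :: "nat \<Rightarrow> family_tree_class \<Rightarrow> family_tree_class \<Rightarrow> bool"
  is "\<lambda>r T T'. \<exists>f. is_iso f (tree_ball r T) (tree_ball r T')"
proof -
  fix r and S S' T T' :: "nat rooted_tree"
  assume "tree_equiv S S'" "tree_equiv T T'"
  then obtain f g where f: "is_iso f (tree_ball r S) (tree_ball r S')"
    and g: "is_iso g (tree_ball r T) (tree_ball r T')"
    unfolding tree_equiv_def by (meson is_iso_ball family_treeD(1,2))
  note f' = is_iso_inv[OF f ball_wf(1)] and g' = is_iso_inv[OF g ball_wf(1)]
  show "(\<exists>h. is_iso h (tree_ball r S) (tree_ball r T)) \<longleftrightarrow>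
        (\<exists>h. is_iso h (tree_ball r S') (tree_ball r T'))"
    using f g f' g' is_iso_comp by meson
qed

lift_definition same_ordered_ball ::
    "nat \<Rightarrow> ordered_family_tree_class \<Rightarrow> ordered_family_tree_class \<Rightarrow> bool"
  is "\<lambda>r T T'. \<exists>f. is_ordered_iso f (ordered_ball r T) (ordered_ball r T')"
proof -
  fix r and S S' T T' :: "nat ordered_tree"
  assume "ordered_tree_equiv S S'" "ordered_tree_equiv T T'"
  then obtain f g where f: "is_ordered_iso f (ordered_ball r S) (ordered_ball r S')"
    and g: "is_ordered_iso g (ordered_ball r T) (ordered_ball r T')"
    unfolding ordered_tree_equiv_def
    by (meson is_ordered_iso_ball family_treeD(1,2) ordered_family_treeD)
  note f' = is_ordered_iso_inv[OF f ordered_ball_wf(1)] and g' = is_ordered_iso_inv[OF g ordered_ball_wf(1)]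
  show "(\<exists>h. is_ordered_iso h (ordered_ball r S) (ordered_ball r T)) \<longleftrightarrow>
        (\<exists>h. is_ordered_iso h (ordered_ball r S') (ordered_ball r T'))"
    using f g f' g' is_ordered_iso_comp by meson
qed

lemma same_ball_refl: "same_ball r x x"
  by transfer (rule exI, rule is_iso_id)

lemma same_ball_trans: "same_ball r x y \<Longrightarrow> same_ball r y z \<Longrightarrow> same_ball r x z"
  by transfer (elim exE, rule exI, rule is_iso_comp)

lemma same_ball_mono: "same_ball s x y \<Longrightarrow> r \<le> s \<Longrightarrow> same_ball r x y"
  by transfer (elim exE, rule exI, rule is_iso_ball_mono)

lemma same_ordered_ball_refl: "same_ordered_ball r x x"
  by transfer (rule exI, rule is_ordered_iso_id)

lemma same_ordered_ball_trans:
  "same_ordered_ball r x y \<Longrightarrow> same_ordered_ball r y z \<Longrightarrow> same_ordered_ball r x z"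
  by transfer (elim exE, rule exI, rule is_ordered_iso_comp)

lemma same_ordered_ball_mono: "same_ordered_ball s x y \<Longrightarrow> r \<le> s \<Longrightarrow> same_ordered_ball r x y"
  by transfer (elim exE, rule exI, rule is_ordered_iso_ball_mono)

instantiation family_tree_class :: topological_space
begin

definition open_family_tree_class :: "family_tree_class set \<Rightarrow> bool" where
  "open_family_tree_class U \<longleftrightarrow> (\<forall>x\<in>U. \<exists>r. \<forall>y. same_ball r x y \<longrightarrow> y \<in> U)"

instance
proof
  fix S T :: "family_tree_class set"
  assume ST: "open S" "open T"
  show "open (S \<inter> T)"
    unfolding open_family_tree_class_def
  proof
    fix x assume "x \<in> S \<inter> T"
    then obtain r s where "\<forall>y. same_ball r x y \<longrightarrow> y \<in> S" "\<forall>y. same_ball s x y \<longrightarrow> y \<in> T"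
      using ST unfolding open_family_tree_class_def by blast
    then have "\<forall>y. same_ball (max r s) x y \<longrightarrow> y \<in> S \<inter> T"
      by (meson IntI same_ball_mono max.cobounded1 max.cobounded2)
    then show "\<exists>r. \<forall>y. same_ball r x y \<longrightarrow> y \<in> S \<inter> T" ..
  qed
next
  show "open (UNIV :: family_tree_class set)" by (simp add: open_family_tree_class_def)
next
  fix K :: "family_tree_class set set"
  assume K: "\<forall>S\<in>K. open S"
  show "open (\<Union>K)"
    unfolding open_family_tree_class_def
  proof
    fix x assume "x \<in> \<Union>K"
    then obtain S where S: "S \<in> K" "x \<in> S" by auto
    then obtain r where "\<forall>y. same_ball r x y \<longrightarrow> y \<in> S"
      using K unfolding open_family_tree_class_def by blast
    then show "\<exists>r. \<forall>y. same_ball r x y \<longrightarrow> y \<in> \<Union>K" using S(1) by auto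
  qed
qed

end

instantiation ordered_family_tree_class :: topological_space
begin

definition open_ordered_family_tree_class :: "ordered_family_tree_class set \<Rightarrow> bool" where
  "open_ordered_family_tree_class U \<longleftrightarrow> (\<forall>x\<in>U. \<exists>r. \<forall>y. same_ordered_ball r x y \<longrightarrow> y \<in> U)"

instance
proof
  fix S T :: "ordered_family_tree_class set"
  assume ST: "open S" "open T"
  show "open (S \<inter> T)"
    unfolding open_ordered_family_tree_class_def
  proof
    fix x assume "x \<in> S \<inter> T"
    then obtain r s
      where "\<forall>y. same_ordered_ball r x y \<longrightarrow> y \<in> S" "\<forall>y. same_ordered_ball s x y \<longrightarrow> y \<in> T"
      using ST unfolding open_ordered_family_tree_class_def by blast
    then have "\<forall>y. same_ordered_ball (max r s) x y \<longrightarrow> y \<in> S \<inter> T"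
      by (meson IntI same_ordered_ball_mono max.cobounded1 max.cobounded2)
    then show "\<exists>r. \<forall>y. same_ordered_ball r x y \<longrightarrow> y \<in> S \<inter> T" ..
  qed
next
  show "open (UNIV :: ordered_family_tree_class set)" by (simp add: open_ordered_family_tree_class_def)
next
  fix K :: "ordered_family_tree_class set set"
  assume K: "\<forall>S\<in>K. open S"
  show "open (\<Union>K)"
    unfolding open_ordered_family_tree_class_def
  proof
    fix x assume "x \<in> \<Union>K"
    then obtain S where S: "S \<in> K" "x \<in> S" by auto
    then obtain r where "\<forall>y. same_ordered_ball r x y \<longrightarrow> y \<in> S"
      using K unfolding open_ordered_family_tree_class_def by blast
    then show "\<exists>r. \<forall>y. same_ordered_ball r x y \<longrightarrow> y \<in> \<Union>K" using S(1) by auto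
  qed
qed

end

lemma tendsto_family_tree_class:
  "(X \<longlongrightarrow> (x :: family_tree_class)) F \<longleftrightarrow> (\<forall>r. \<forall>\<^sub>F n in F. same_ball r x (X n))"
proof safe
  fix r assume "(X \<longlongrightarrow> x) F"
  moreover have "open {y. same_ball r x y}"
    unfolding open_family_tree_class_def using same_ball_trans by blast
  ultimately show "\<forall>\<^sub>F n in F. same_ball r x (X n)"
    using same_ball_refl by (auto dest: topological_tendstoD)
next
  assume *: "\<forall>r. \<forall>\<^sub>F n in F. same_ball r x (X n)"
  show "(X \<longlongrightarrow> x) F"
  proof (rule topological_tendstoI)
    fix S assume "open S" "x \<in> S"
    then obtain r where "\<forall>y. same_ball r x y \<longrightarrow> y \<in> S"
      unfolding open_family_tree_class_def by blast
    then show "\<forall>\<^sub>F n in F. X n \<in> S" using *[rule_format, of r] by (auto elim: eventually_mono)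
  qed
qed

lemma tendsto_ordered_family_tree_class:
  "(X \<longlongrightarrow> (x :: ordered_family_tree_class)) F \<longleftrightarrow>
     (\<forall>r. \<forall>\<^sub>F n in F. same_ordered_ball r x (X n))"
proof safe
  fix r assume "(X \<longlongrightarrow> x) F"
  moreover have "open {y. same_ordered_ball r x y}"
    unfolding open_ordered_family_tree_class_def using same_ordered_ball_trans by blast
  ultimately show "\<forall>\<^sub>F n in F. same_ordered_ball r x (X n)"
    using same_ordered_ball_refl by (auto dest: topological_tendstoD)
next
  assume *: "\<forall>r. \<forall>\<^sub>F n in F. same_ordered_ball r x (X n)"
  show "(X \<longlongrightarrow> x) F"
  proof (rule topological_tendstoI)
    fix S assume "open S" "x \<in> S"
    then obtain r where "\<forall>y. same_ordered_ball r x y \<longrightarrow> y \<in> S"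
      unfolding open_ordered_family_tree_class_def by blast
    then show "\<forall>\<^sub>F n in F. X n \<in> S" using *[rule_format, of r] by (auto elim: eventually_mono)
  qed
qed

definition relabel :: "('v \<Rightarrow> 'w) \<Rightarrow> 'v ordered_tree \<Rightarrow> 'w ordered_tree" where
  "relabel f T = \<lparr>verts = f ` verts T, arcs = map_prod f f ` arcs T, origin = f (origin T),
                  sib = map_prod f f ` sib T\<rparr>"

definition tree_class :: "'v::countable ordered_tree \<Rightarrow> ordered_family_tree_class" where
  "tree_class T = abs_ordered_family_tree_class (relabel to_nat T)"

definition weakly_converges :: "(nat \<Rightarrow> 'a::topological_space measure) \<Rightarrow> 'a measure \<Rightarrow> bool" where
  "weakly_converges P Q \<longleftrightarrow>
     (\<forall>n. prob_space (P n) \<and> sets (P n) = sets borel) \<and>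
     prob_space Q \<and> sets Q = sets borel \<and>
     (\<forall>f :: 'a \<Rightarrow> real. continuous_on UNIV f \<and> bounded (range f) \<longrightarrow>
        (\<lambda>n. \<integral>x. f x \<partial>P n) \<longlonglongrightarrow> (\<integral>x. f x \<partial>Q))"

text \<open>For a vertex-shift acting on rooted trees by \<open>F\<close>, i.e. by \<open>[T, o] \<mapsto> [T, F(o)]\<close>, the law \<open>Q\<close>
  is the \<open>F\<close>-probability of the law \<open>P\<close>.\<close>

definition is_shift_probability ::
    "('a::topological_space \<Rightarrow> 'a) \<Rightarrow> 'a measure \<Rightarrow> 'a measure \<Rightarrow> bool" where
  "is_shift_probability F P Q \<longleftrightarrow> weakly_converges (\<lambda>n. distr P borel (F ^^ n)) Q"

text \<open>The weights sum to 1 if \<open>p\<close> has mean 1; otherwise \<open>size_biased p\<close> is not meaningful.\<close>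

definition size_biased :: "nat pmf \<Rightarrow> nat pmf" where
  "size_biased p = embed_pmf (\<lambda>k. real k * pmf p k)"

text \<open>An offspring is a list that contains each of \<open>0, \<dots>, k - 1\<close> once: the \<open>k\<close> children, listed in
  their order. Given \<open>k\<close>, this order is uniform.\<close>

definition offspring :: "nat pmf \<Rightarrow> nat list pmf" where
  "offspring p = bind_pmf p (\<lambda>k. pmf_of_set (permutations_of_set {..<k}))"

text \<open>The vertices are labelled as follows: \<open>(n, [])\<close> is the \<open>n\<close>-th vertex of the distinguished
  directed path, whose parent is \<open>(n + 1, [])\<close>, and \<open>(n, w)\<close> is reached from \<open>(n, [])\<close> by following
  the child indices in \<open>w\<close> downwards. The set \<open>S\<close> contains those \<open>n\<close> for which \<open>(n, [])\<close> has
  size-biased offspring; for such \<open>n\<close>, the child of index \<open>0\<close> of \<open>(n, [])\<close> is \<open>(n - 1, [])\<close>.\<close>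

type_synonym label = "int \<times> nat list"

definition child :: "int set \<Rightarrow> label \<Rightarrow> nat \<Rightarrow> label" where
  "child S v i = (case v of (n, w) \<Rightarrow>
     if n \<in> S \<and> w = [] \<and> i = 0 then (n - 1, []) else (n, w @ [i]))"

inductive_set labels :: "int set \<Rightarrow> (label \<Rightarrow> nat list) \<Rightarrow> label set"
  for S :: "int set" and \<omega> :: "label \<Rightarrow> nat list" where
  spine: "n \<in> S \<Longrightarrow> (n, []) \<in> labels S \<omega>"
| child: "v \<in> labels S \<omega> \<Longrightarrow> i \<in> set (\<omega> v) \<Longrightarrow> child S v i \<in> labels S \<omega>"

definition spine_tree :: "int set \<Rightarrow> (label \<Rightarrow> nat list) \<Rightarrow> label ordered_tree" where
  "spine_tree S \<omega> =
     \<lparr>verts = labels S \<omega>,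
      arcs = {(child S v i, v) | v i. v \<in> labels S \<omega> \<and> i \<in> set (\<omega> v)},
      origin = (0, []),
      sib = {(child S v (\<omega> v ! a), child S v (\<omega> v ! b)) | v a b.
               v \<in> labels S \<omega> \<and> a < b \<and> b < length (\<omega> v)}\<rparr>"

definition reproduction :: "int set \<Rightarrow> nat pmf \<Rightarrow> (label \<Rightarrow> nat list) measure" where
  "reproduction S p =
     (\<Pi>\<^sub>M (n, w)\<in>UNIV. measure_pmf (offspring (if n \<in> S \<and> w = [] then size_biased p else p)))"

definition EGWT :: "nat pmf \<Rightarrow> ordered_family_tree_class measure" where
  "EGWT p = distr (reproduction {1..} p) borel (\<lambda>\<omega>. tree_class (spine_tree {1..} \<omega>))"

definition EKT :: "nat pmf \<Rightarrow> ordered_family_tree_class measure" where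
  "EKT p = distr (reproduction UNIV p) borel (\<lambda>\<omega>. tree_class (spine_tree UNIV \<omega>))"

definition unordered :: "ordered_family_tree_class measure \<Rightarrow> family_tree_class measure" where
  "unordered P = distr P borel forget_order"

end

theory Submission
  imports Defs
begin

text \<open>Seen from the \<open>n\<close>-th ancestor of its root, \<open>EGWT(p)\<close> is the spine tree in which exactly the
  path vertices of index at least \<open>1 - n\<close> have size-biased offspring. All these trees and
  \<open>EKT(p)\<close> are realised on one probability space, which carries for each label an offspring for the
  Kesten tree and an independent unbiased one: the \<open>n\<close>-th tree uses the former at labels with first
  coordinate at least \<open>1 - n\<close> and the latter elsewhere. Every vertex of the ball of radius \<open>r\<close>
  around the root has first coordinate at least \<open>-r\<close>, so for \<open>n > r\<close> the two trees have the same
  ball. Thus the coupled trees converge almost surely, and dominated convergence gives convergence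
  in distribution. Forgetting the order is continuous and commutes with the shift, whence the
  unordered statement.\<close>

section \<open>Continuity of the parent shift\<close>

text \<open>The laws are Borel measures on a quotient type, and \<open>distr\<close> has its
  intended meaning only for measurable maps. No completion is taken, so the map from offspring to
  trees must be measurable as a whole, including the null outcomes whose graph is no Family Tree and
  whose class is a default value. This is handled by finite codes of balls: every open set is a
  countable union of sets of trees sharing a code, and whether the random tree has a given code is a
  countable combination of events about single offspring lists.

  The mean is the total mass of the weights \<open>k * p k\<close>. Mean 1 therefore makes the
  size-biased law a genuine distribution with no mass at \<open>0\<close>, so that almost surely
  each path vertex with such offspring has the child of index \<open>0\<close> that continues the
  path downwards.

  The coupling is free to choose the joint law of the trees for different \<open>n\<close>, since
  convergence in distribution only sees each law separately. The unbiased copy is there because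
  below the threshold the Kesten offspring of a path vertex has the wrong law for
  \<open>EGWT\<close>.\<close>

lemma rtrancl_adj_sym: "(u, v) \<in> (adj T)\<^sup>* \<Longrightarrow> (v, u) \<in> (adj T)\<^sup>*"
  by (rule symD[OF sym_rtrancl]) (auto simp: sym_def adj_def)

lemma rtrancl_origin_if_in_ball:
  assumes "v \<in> ball_verts r T" shows "(origin T, v) \<in> (adj T)\<^sup>*"
  using assms by (auto simp: ball_verts_def intro: relpow_imp_rtrancl)

lemma adj_tree_ball_subset: "adj (tree_ball r T) \<subseteq> adj T"
  by (auto simp: adj_def tree_ball_def)

text \<open>Makes \<open>move_root_iso\<close> applicable to balls. Only connectedness needs care: a
  vertex of the ball is joined to the root inside the ball, because by
  \<open>ball_of_ball_verts\<close> truncation keeps the short walks from the root. The other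
  conditions pass to a subgraph.\<close>

lemma family_tree_tree_ball:
  assumes "family_tree T" shows "family_tree (tree_ball r T)"
proof -
  let ?B = "tree_ball r T"
  have "arcs ?B \<subseteq> arcs T" "origin ?B = origin T" "verts ?B = ball_verts r T"
    by (auto simp: tree_ball_def)
  moreover have "ball_verts r T \<subseteq> verts T"
    using assms ball_verts_subset by (auto simp: family_tree_def)
  moreover have "finite {u. (u, v) \<in> adj ?B}" if "v \<in> ball_verts r T" for v
  proof (rule finite_subset)
    show "{u. (u, v) \<in> adj ?B} \<subseteq> {u. (u, v) \<in> adj T}" using adj_tree_ball_subset by blast
    show "finite {u. (u, v) \<in> adj T}" using assms that calculation by (auto simp: family_tree_def)
  qed
  moreover have "(u, v) \<in> (adj ?B)\<^sup>*" if "u \<in> ball_verts r T" "v \<in> ball_verts r T" for u v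
  proof -
    have "(origin ?B, x) \<in> (adj ?B)\<^sup>*" if "x \<in> ball_verts r T" for x
      using that rtrancl_origin_if_in_ball[of x r ?B] by (simp add: ball_of_ball_verts)
    from this[OF that(1)] this[OF that(2)] show ?thesis
      by (meson rtrancl_adj_sym rtrancl_trans)
  qed
  moreover have "(u, v) \<notin> (adj ?B - {(u, v), (v, u)})\<^sup>*" if "(u, v) \<in> arcs ?B" for u v
  proof
    assume "(u, v) \<in> (adj ?B - {(u, v), (v, u)})\<^sup>*"
    then have "(u, v) \<in> (adj T - {(u, v), (v, u)})\<^sup>*"
      using rtrancl_mono[of "adj ?B - {(u, v), (v, u)}" "adj T - {(u, v), (v, u)}"]
        adj_tree_ball_subset by blast
    then show False using that assms calculation(1) by (auto simp: family_tree_def)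
  qed
  ultimately show ?thesis
    using assms ball_wf[of r T] single_valued_subset[of "arcs ?B" "arcs T"]
    by (auto simp: family_tree_def)
qed

lemma origin_move_root_eq:
  assumes "single_valued (arcs T)" "(origin T, p) \<in> arcs T"
  shows "origin (move_root T) = p"
proof -
  have "(THE q. (origin T, q) \<in> arcs T) = p" using assms by (auto simp: single_valued_def)
  then show ?thesis using assms by (auto simp: move_root_def)
qed

lemma arcs_from_origin_in_ball:
  "(origin T, p) \<in> arcs T \<Longrightarrow> (origin T, p) \<in> arcs (tree_ball (Suc r) T)"
  unfolding tree_ball_def ball_verts_def
  by (auto intro: exI[of _ 0] exI[of _ "Suc 0"] simp: adj_def)

text \<open>A ball of positive radius contains the parent of its root whenever there is one, so
  truncation does not change which branch of \<open>move_root\<close> applies. This is why the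
  radius is a successor.\<close>

lemma origin_move_root_ball:
  assumes "single_valued (arcs T)"
  shows "origin (move_root (tree_ball (Suc r) T)) = origin (move_root T)"
proof (cases "\<exists>p. (origin T, p) \<in> arcs T")
  case True
  then obtain p where p: "(origin T, p) \<in> arcs T" by auto
  have "single_valued (arcs (tree_ball (Suc r) T))"
    using assms by (rule single_valued_subset[rotated]) (auto simp: tree_ball_def)
  then show ?thesis
    using p origin_move_root_eq[OF assms p] arcs_from_origin_in_ball[OF p, of r]
      origin_move_root_eq[of "tree_ball (Suc r) T" p] by (simp add: tree_ball_def)
next
  case False
  then show ?thesis by (auto simp: move_root_def tree_ball_def)
qed

lemma origin_move_root_cases:
  assumes "single_valued (arcs T)"
  shows "origin (move_root T) = origin T \<or> (origin T, origin (move_root T)) \<in> adj T"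
proof (cases "\<exists>p. (origin T, p) \<in> arcs T")
  case True
  then show ?thesis using origin_move_root_eq[OF assms] by (auto simp: adj_def)
qed (auto simp: move_root_def)

text \<open>The new root is the old one or a neighbour of it, so prefixing the move costs at most
  one step.\<close>

lemma walk_from_parent:
  assumes "single_valued (arcs T)" "(origin (move_root T), v) \<in> adj T ^^ k"
  shows "v \<in> ball_verts (Suc k) T"
proof -
  have "(origin T, v) \<in> adj T ^^ k \<or> (origin T, v) \<in> adj T ^^ Suc k"
    using origin_move_root_cases[OF assms(1)] assms(2) relpow_Suc_I2 by metis
  then show ?thesis unfolding ball_verts_def using le_SucI by blast
qed

lemma ball_verts_move_root_subset:
  assumes "single_valued (arcs T)"
  shows "ball_verts r (move_root T) \<subseteq> ball_verts (Suc r) T"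
proof
  fix v assume "v \<in> ball_verts r (move_root T)"
  then obtain k where "k \<le> r" "(origin (move_root T), v) \<in> adj T ^^ k"
    by (auto simp: ball_verts_def)
  then show "v \<in> ball_verts (Suc r) T"
    using walk_from_parent[OF assms] ball_verts_mono[of "Suc k" "Suc r" T] by auto
qed

lemma ball_verts_move_root_ball:
  assumes "single_valued (arcs T)"
  shows "ball_verts r (move_root (tree_ball (Suc r) T)) = ball_verts r (move_root T)"
proof -
  let ?B = "tree_ball (Suc r) T" and ?o = "origin (move_root T)"
  have "(?o, v) \<in> adj ?B ^^ k" if "(?o, v) \<in> adj T ^^ k" "k \<le> r" for v k
    using that
  proof (induction k arbitrary: v)
    case (Suc k)
    then obtain u where u: "(?o, u) \<in> adj T ^^ k" "(u, v) \<in> adj T" by auto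
    have "u \<in> ball_verts (Suc r) T" "v \<in> ball_verts (Suc r) T"
      using walk_from_parent[OF assms u(1)] walk_from_parent[OF assms Suc.prems(1)] Suc.prems(2)
        ball_verts_mono[of "Suc k" "Suc r" T] ball_verts_mono[of "Suc (Suc k)" "Suc r" T] by auto
    then have "(u, v) \<in> adj ?B" using u(2) by (auto simp: adj_def tree_ball_def)
    then show ?case using Suc.IH[OF u(1)] Suc.prems by auto
  qed simp
  moreover have "(?o, v) \<in> adj T ^^ k" if "(?o, v) \<in> adj ?B ^^ k" for v k
    using that adj_tree_ball_subset[of "Suc r" T]
    by (induction k arbitrary: v) auto
  ultimately show ?thesis
    unfolding ball_verts_def origin_move_root_ball[OF assms] move_root_simps by blast
qed

text \<open>Shows that the shift is a local operation: the ball after the move can be computed from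
  a ball one unit larger before it. Continuity then reduces to isomorphism invariance, applied to
  the larger balls as trees in their own right.\<close>

lemma tree_ball_move_root_ball:
  assumes "single_valued (arcs T)"
  shows "tree_ball r (move_root (tree_ball (Suc r) T)) = tree_ball r (move_root T)"
  using ball_verts_move_root_ball[OF assms, of r] origin_move_root_ball[OF assms, of r]
    ball_verts_move_root_subset[OF assms, of r]
    Restr_subset[OF ball_verts_move_root_subset[OF assms, of r], of "arcs T"]
  by (simp add: tree_ball_def move_root_def)

lemma is_iso_move_root_ball:
  assumes "is_iso f (tree_ball (Suc r) T) (tree_ball (Suc r) T')" "family_tree T" "family_tree T'"
  shows "is_iso f (tree_ball r (move_root T)) (tree_ball r (move_root T'))"
proof -
  let ?M = "move_root (tree_ball (Suc r) T)" and ?M' = "move_root (tree_ball (Suc r) T')"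
  have M: "family_tree ?M" "family_tree ?M'"
    using assms by (simp_all add: family_tree_tree_ball move_root_family_tree)
  have "is_iso f ?M ?M'"
    using assms by (intro move_root_iso family_tree_tree_ball)
  then have "is_iso f (tree_ball r ?M) (tree_ball r ?M')"
    using M by (intro is_iso_ball family_treeD)
  then show ?thesis
    by (simp add: tree_ball_move_root_ball family_treeD[OF assms(2)] family_treeD[OF assms(3)])
qed

lemma is_iso_ordered_ball:
  "is_iso f (ordered_ball r T) (ordered_ball r T') \<longleftrightarrow> is_iso f (tree_ball r T) (tree_ball r T')"
  by (simp add: is_iso_def ordered_ball_def)

lemma is_ordered_iso_move_root_ball:
  assumes "is_ordered_iso f (ordered_ball (Suc r) T) (ordered_ball (Suc r) T')"
    "family_tree T" "family_tree T'"
  shows "is_ordered_iso f (ordered_ball r (move_root T)) (ordered_ball r (move_root T'))"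
proof -
  have 1: "is_iso f (tree_ball r (move_root T)) (tree_ball r (move_root T'))"
    using assms by (intro is_iso_move_root_ball) (auto simp: is_ordered_iso_def is_iso_ordered_ball)
  then have "f ` ball_verts r (move_root T) = ball_verts r (move_root T')"
    by (auto simp: is_iso_def bij_betw_def tree_ball_def)
  moreover note ball_verts_move_root_subset[OF family_treeD(3)[OF assms(2)], of r]
    ball_verts_move_root_subset[OF family_treeD(3)[OF assms(3)], of r]
  moreover have "(u, v) \<in> sib T \<longleftrightarrow> (f u, f v) \<in> sib T'"
    if uv: "u \<in> ball_verts r (move_root T)" "v \<in> ball_verts r (move_root T)" for u v
  proof -
    have "u \<in> ball_verts (Suc r) T" "v \<in> ball_verts (Suc r) T"
      "f u \<in> ball_verts (Suc r) T'" "f v \<in> ball_verts (Suc r) T'"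
      using uv calculation by auto
    then show ?thesis using assms(1)
      by (simp add: is_ordered_iso_def ordered_ball_def tree_ball_def)
  qed
  ultimately show ?thesis using 1 unfolding is_ordered_iso_def is_iso_ordered_ball
    by (simp add: ordered_ball_def tree_ball_def) blast
qed

lemma same_ball_parent_shift:
  "same_ball (Suc r) x y \<Longrightarrow> same_ball r (parent_shift x) (parent_shift y)"
  by transfer (auto simp: tree_equiv_def intro: is_iso_move_root_ball)

lemma same_ordered_ball_ordered_parent_shift:
  "same_ordered_ball (Suc r) x y \<Longrightarrow>
    same_ordered_ball r (ordered_parent_shift x) (ordered_parent_shift y)"
  by transfer (auto simp: ordered_tree_equiv_def ordered_family_tree_def
      intro: is_ordered_iso_move_root_ball)

lemma tree_ball_truncate:
  "tree_ball r (rooted_tree.truncate T) = rooted_tree.truncate (ordered_ball r T)"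
  by (simp add: tree_ball_def ordered_ball_def rooted_tree.truncate_def ball_verts_def adj_def)

lemma is_iso_truncate:
  "is_iso f (rooted_tree.truncate T) (rooted_tree.truncate T') \<longleftrightarrow> is_iso f T T'"
  by (simp add: is_iso_def rooted_tree.truncate_def)

lemma same_ball_forget_order:
  "same_ordered_ball r x y \<Longrightarrow> same_ball r (forget_order x) (forget_order y)"
  by transfer (auto simp: is_ordered_iso_def is_iso_truncate tree_ball_truncate)

lemma continuous_parent_shift: "continuous_on UNIV parent_shift"
  unfolding continuous_on_open_vimage[OF open_UNIV] open_family_tree_class_def
  by (metis IntI Int_iff UNIV_I same_ball_parent_shift vimage_eq)

lemma continuous_ordered_parent_shift: "continuous_on UNIV ordered_parent_shift"
  unfolding continuous_on_open_vimage[OF open_UNIV] open_ordered_family_tree_class_def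
  by (metis IntI Int_iff UNIV_I same_ordered_ball_ordered_parent_shift vimage_eq)

lemma continuous_forget_order: "continuous_on UNIV forget_order"
  unfolding continuous_on_open_vimage[OF open_UNIV] open_ordered_family_tree_class_def
    open_family_tree_class_def
  by (metis IntI Int_iff UNIV_I same_ball_forget_order vimage_eq)

lemma forget_order_ordered_parent_shift:
  "forget_order (ordered_parent_shift x) = parent_shift (forget_order x)"
proof transfer
  fix T T' :: "nat ordered_tree"
  assume e: "ordered_tree_equiv T T'"
  have "rooted_tree.truncate (move_root T) = move_root (rooted_tree.truncate T)"
    for T :: "nat ordered_tree"
    by (simp add: move_root_def rooted_tree.truncate_def)
  moreover have "tree_equiv (rooted_tree.truncate T) (rooted_tree.truncate T')"
    using forget_order.rsp e by (auto dest: rel_funD)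
  ultimately show "tree_equiv (rooted_tree.truncate (move_root T)) (move_root (rooted_tree.truncate T'))"
    by (metis (no_types, lifting) tree_equiv_def move_root_iso move_root_family_tree)
qed

section \<open>Measurability of random trees\<close>

type_synonym ball_code = "nat \<times> nat \<times> (nat \<times> nat) list \<times> (nat \<times> nat) list"

text \<open>Here \<open>xs\<close> enumerates the ball, \<open>m\<close> is the position of the
  root, and \<open>E\<close> and \<open>R\<close> list the index pairs of the arcs and of the
  sibling order. A ball has many codes, since enumeration and listings are arbitrary; what matters
  is that codes form a countable type and determine the ball up to isomorphism.\<close>

definition ball_code :: "nat \<Rightarrow> 'v ordered_tree \<Rightarrow> ball_code \<Rightarrow> bool" where
  "ball_code r T c = (case c of (n, m, E, R) \<Rightarrow>
     \<exists>xs. length xs = n \<and> distinct xs \<and> set xs = ball_verts r T \<and> m < n \<and> xs ! m = origin T \<and>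
       (\<forall>i<n. \<forall>j<n. (xs ! i, xs ! j) \<in> arcs T \<longleftrightarrow> (i, j) \<in> set E) \<and>
       (\<forall>i<n. \<forall>j<n. (xs ! i, xs ! j) \<in> sib T \<longleftrightarrow> (i, j) \<in> set R))"

lemma finite_ball_verts:
  assumes "family_tree T" shows "finite (ball_verts r T)"
proof -
  have sub: "ball_verts k T \<subseteq> verts T" for k using assms ball_verts_subset family_treeD by blast
  have "finite {v. (origin T, v) \<in> adj T ^^ k}" for k
  proof (induction k)
    case (Suc k)
    have "{v. (origin T, v) \<in> adj T ^^ Suc k}
        = (\<Union>u\<in>{u. (origin T, u) \<in> adj T ^^ k}. {v. (v, u) \<in> adj T})"
      by (auto simp: adj_def)
    moreover have "u \<in> verts T" if "(origin T, u) \<in> adj T ^^ k" for u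
      using that sub[of k] by (auto simp: ball_verts_def)
    ultimately show ?case using Suc assms by (auto simp: family_tree_def)
  qed simp
  moreover have "ball_verts r T = (\<Union>k\<in>{..r}. {v. (origin T, v) \<in> adj T ^^ k})"
    by (auto simp: ball_verts_def)
  ultimately show ?thesis by simp
qed

lemma ball_code_exists:
  assumes "family_tree T" shows "\<exists>c. ball_code r T c"
proof -
  obtain xs where xs: "set xs = ball_verts r T" "distinct xs"
    using finite_distinct_list[OF finite_ball_verts[OF assms]] by blast
  obtain m where m: "m < length xs" "xs ! m = origin T"
    using xs(1) origin_in_ball[of T r] by (metis in_set_conv_nth)
  have *: "\<exists>L. set L = {(i, j). i < length xs \<and> j < length xs \<and> (xs ! i, xs ! j) \<in> R}" for R
  proof (rule finite_list, rule finite_subset)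
    show "{(i, j). i < length xs \<and> j < length xs \<and> (xs ! i, xs ! j) \<in> R}
      \<subseteq> {..<length xs} \<times> {..<length xs}" by auto
  qed simp
  obtain E where "set E = {(i, j). i < length xs \<and> j < length xs \<and> (xs ! i, xs ! j) \<in> arcs T}"
    using *[of "arcs T"] by blast
  moreover obtain R where "set R = {(i, j). i < length xs \<and> j < length xs \<and> (xs ! i, xs ! j) \<in> sib T}"
    using *[of "sib T"] by blast
  ultimately have "ball_code r T (length xs, m, E, R)"
    unfolding ball_code_def using xs m by (simp add: exI[of _ xs])
  then show ?thesis ..
qed

text \<open>Entries at equal positions of the two enumerations are matched; every relation to be
  preserved is then a statement about indices, which the common code decides.\<close>

lemma is_ordered_iso_if_ball_code:
  assumes "ball_code r T c" "ball_code r T' c"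
  shows "\<exists>f. is_ordered_iso f (ordered_ball r T) (ordered_ball r T')"
proof -
  obtain n m E R where c: "c = (n, m, E, R)" by (cases c)
  obtain xs where xs: "length xs = n" "distinct xs" "set xs = ball_verts r T"
      "m < n" "xs ! m = origin T"
      "\<And>i j. i < n \<Longrightarrow> j < n \<Longrightarrow> (xs ! i, xs ! j) \<in> arcs T \<longleftrightarrow> (i, j) \<in> set E"
      "\<And>i j. i < n \<Longrightarrow> j < n \<Longrightarrow> (xs ! i, xs ! j) \<in> sib T \<longleftrightarrow> (i, j) \<in> set R"
    using assms(1) unfolding ball_code_def c by auto
  obtain ys where ys: "length ys = n" "distinct ys" "set ys = ball_verts r T'"
      "m < n" "ys ! m = origin T'"
      "\<And>i j. i < n \<Longrightarrow> j < n \<Longrightarrow> (ys ! i, ys ! j) \<in> arcs T' \<longleftrightarrow> (i, j) \<in> set E"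
      "\<And>i j. i < n \<Longrightarrow> j < n \<Longrightarrow> (ys ! i, ys ! j) \<in> sib T' \<longleftrightarrow> (i, j) \<in> set R"
    using assms(2) unfolding ball_code_def c by auto
  define f where "f v = the (map_of (zip xs ys) v)" for v
  have f: "f (xs ! i) = ys ! i" if "i < n" for i
    using that xs(1,2) ys(1) by (simp add: f_def map_of_zip_nth)
  have nx: "(\<forall>v\<in>ball_verts r T. P v) \<longleftrightarrow> (\<forall>i<n. P (xs ! i))" for P
    using xs(1) by (simp add: all_set_conv_all_nth flip: xs(3))
  have "bij_betw f (ball_verts r T) (ball_verts r T')"
  proof (rule bij_betw_imageI)
    show "inj_on f (ball_verts r T)" unfolding inj_on_def nx
      using f ys(1,2) by (simp add: nth_eq_iff_index_eq)
    have "map f xs = ys" using f xs(1) ys(1) by (simp add: list_eq_iff_nth_eq)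
    then show "f ` ball_verts r T = ball_verts r T'"
      using xs(3) ys(3) by (metis list.set_map)
  qed
  moreover have "f (origin T) = origin T'" using f[of m] xs(4,5) ys(5) by simp
  moreover have "(\<forall>u\<in>ball_verts r T. \<forall>v\<in>ball_verts r T.
      ((u, v) \<in> arcs T \<longleftrightarrow> (f u, f v) \<in> arcs T') \<and> ((u, v) \<in> sib T \<longleftrightarrow> (f u, f v) \<in> sib T'))"
    unfolding nx using f xs(6,7) ys(6,7) by simp
  moreover have "f v \<in> ball_verts r T'" if "v \<in> ball_verts r T" for v
    using that calculation(1) by (auto dest: bij_betwE)
  ultimately have "is_ordered_iso f (ordered_ball r T) (ordered_ball r T')"
    unfolding is_ordered_iso_def is_iso_def by (simp add: ordered_ball_def tree_ball_def)
  then show ?thesis by blast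
qed

lemma ball_code_iso:
  assumes "ball_code r T c" "is_ordered_iso f (ordered_ball r T) (ordered_ball r T')"
  shows "ball_code r T' c"
proof -
  obtain n m E R where c: "c = (n, m, E, R)" by (cases c)
  obtain xs where xs: "length xs = n" "distinct xs" "set xs = ball_verts r T"
      "m < n" "xs ! m = origin T"
      "\<And>i j. i < n \<Longrightarrow> j < n \<Longrightarrow> (xs ! i, xs ! j) \<in> arcs T \<longleftrightarrow> (i, j) \<in> set E"
      "\<And>i j. i < n \<Longrightarrow> j < n \<Longrightarrow> (xs ! i, xs ! j) \<in> sib T \<longleftrightarrow> (i, j) \<in> set R"
    using assms(1) unfolding ball_code_def c by auto
  have b: "bij_betw f (ball_verts r T) (ball_verts r T')" and o: "f (origin T) = origin T'"
    and a: "\<And>u v. u \<in> ball_verts r T \<Longrightarrow> v \<in> ball_verts r T \<Longrightarrow>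
      ((u, v) \<in> arcs T \<longleftrightarrow> (f u, f v) \<in> arcs T') \<and> ((u, v) \<in> sib T \<longleftrightarrow> (f u, f v) \<in> sib T')"
    using assms(2) unfolding is_ordered_iso_def is_iso_def
    by (auto simp: ordered_ball_def tree_ball_def dest: bij_betwE)
  have mem: "xs ! i \<in> ball_verts r T" if "i < n" for i
    using that xs(1,3) nth_mem by blast
  have "length (map f xs) = n \<and> distinct (map f xs) \<and> set (map f xs) = ball_verts r T' \<and>
    m < n \<and> map f xs ! m = origin T' \<and>
       (\<forall>i<n. \<forall>j<n. (map f xs ! i, map f xs ! j) \<in> arcs T' \<longleftrightarrow> (i, j) \<in> set E) \<and>
       (\<forall>i<n. \<forall>j<n. (map f xs ! i, map f xs ! j) \<in> sib T' \<longleftrightarrow> (i, j) \<in> set R)"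
    using xs(1-5) b o a mem by (simp add: bij_betw_def distinct_map flip: xs(6,7))
  then show ?thesis unfolding ball_code_def c by blast
qed

text \<open>Evaluated at the representative selected by the quotient; by
  \<open>ball_code_equiv\<close> all representatives have the same codes.\<close>

definition class_ball_code :: "nat \<Rightarrow> ordered_family_tree_class \<Rightarrow> ball_code \<Rightarrow> bool" where
  "class_ball_code r x = ball_code r (rep_ordered_family_tree_class x)"

lemma ball_code_equiv:
  assumes "ball_code r T c" "ordered_tree_equiv T T'"
  shows "ball_code r T' c"
proof -
  obtain f where "family_tree T" "family_tree T'" "is_ordered_iso f T T'"
    using assms(2) by (auto simp: ordered_tree_equiv_def ordered_family_tree_def)
  then have "is_ordered_iso f (ordered_ball r T) (ordered_ball r T')"
    by (intro is_ordered_iso_ball family_treeD)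
  then show ?thesis by (rule ball_code_iso[OF assms(1)])
qed

lemma ordered_tree_equiv_refl: "ordered_family_tree T \<Longrightarrow> ordered_tree_equiv T T"
  using is_ordered_iso_id by (auto simp: ordered_tree_equiv_def)

lemma class_ball_code_abs:
  assumes "ordered_family_tree T"
  shows "class_ball_code r (abs_ordered_family_tree_class T) c \<longleftrightarrow> ball_code r T c"
proof -
  have "ordered_tree_equiv (rep_ordered_family_tree_class (abs_ordered_family_tree_class T)) T"
    using ordered_tree_equiv_refl[OF assms]
    by (rule Quotient3_rep_abs[OF Quotient3_ordered_family_tree_class])
  then show ?thesis
    using ball_code_equiv ordered_tree_equiv_sym unfolding class_ball_code_def by blast
qed

lemma class_ball_code_exists: "\<exists>c. class_ball_code r x c"
proof -
  have "ordered_tree_equiv (rep_ordered_family_tree_class x) (rep_ordered_family_tree_class x)"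
    by (rule Quotient3_rep_reflp[OF Quotient3_ordered_family_tree_class])
  then show ?thesis unfolding class_ball_code_def
    by (intro ball_code_exists) (auto simp: ordered_tree_equiv_def ordered_family_tree_def)
qed

lemma same_ordered_ball_if_code:
  assumes "class_ball_code r x c" "class_ball_code r y c"
  shows "same_ordered_ball r x y"
  using assms is_ordered_iso_if_ball_code unfolding class_ball_code_def same_ordered_ball.rep_eq
  by blast

text \<open>Around each of its points \<open>U\<close> contains all trees with the same ball of some
  radius, hence all trees that share a code of this ball. The union is indexed by radii and codes
  instead of points, which makes it countable.\<close>

lemma open_eq_countable_Union:
  assumes "open (U :: ordered_family_tree_class set)"
  shows "U = (\<Union>(r, c)\<in>{(r, c). {y. class_ball_code r y c} \<subseteq> U}. {y. class_ball_code r y c})"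
proof
  show "U \<subseteq> (\<Union>(r, c)\<in>{(r, c). {y. class_ball_code r y c} \<subseteq> U}. {y. class_ball_code r y c})"
  proof
    fix x assume "x \<in> U"
    then obtain r where r: "\<And>y. same_ordered_ball r x y \<Longrightarrow> y \<in> U"
      using assms unfolding open_ordered_family_tree_class_def by blast
    obtain c where c: "class_ball_code r x c" using class_ball_code_exists by blast
    then have "{y. class_ball_code r y c} \<subseteq> U" using r same_ordered_ball_if_code by blast
    then show "x \<in> (\<Union>(r, c)\<in>{(r, c). {y. class_ball_code r y c} \<subseteq> U}. {y. class_ball_code r y c})"
      using c by blast
  qed
qed auto

lemma borel_measurable_if_ball_codes:
  fixes f :: "'a \<Rightarrow> ordered_family_tree_class"
  assumes "\<And>r c. Measurable.pred M (\<lambda>\<omega>. class_ball_code r (f \<omega>) c)"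
  shows "f \<in> borel_measurable M"
proof (rule borel_measurableI)
  fix U :: "ordered_family_tree_class set"
  assume "open U"
  let ?I = "{(r, c). {y. class_ball_code r y c} \<subseteq> U}"
  have "f -` U \<inter> space M = (\<Union>(r, c)\<in>?I. {\<omega>\<in>space M. class_ball_code r (f \<omega>) c})"
    by (subst open_eq_countable_Union[OF \<open>open U\<close>]) auto
  also have "\<dots> \<in> sets M"
    using assms by (intro sets.countable_UN') (auto simp: pred_def)
  finally show "f -` U \<inter> space M \<in> sets M" .
qed

section \<open>Events defined by countable quantification\<close>

lemma pred_const: "Measurable.pred M (\<lambda>_. K)"
  by simp

lemma pred_if_eq: "Measurable.pred M P \<Longrightarrow> (\<And>\<omega>. Q \<omega> \<longleftrightarrow> P \<omega>) \<Longrightarrow> Measurable.pred M Q"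
  by presburger

text \<open>Closure under connectives and under quantifiers over countable types. Each property of a
  random tree is rewritten below as such a formula over membership events, and its measurability
  then follows the syntax.\<close>

lemmas pred_intros = pred_const pred_intros_countable pred_intros_logic(2-6)

lemma pred_relpow:
  fixes R :: "'a \<Rightarrow> ('v::countable \<times> 'v) set"
  assumes R: "\<And>x y. Measurable.pred M (\<lambda>\<omega>. (x, y) \<in> R \<omega>)"
  shows "Measurable.pred M (\<lambda>\<omega>. (x, y) \<in> R \<omega> ^^ k)"
proof (induction k arbitrary: y)
  case (Suc k)
  have "Measurable.pred M (\<lambda>\<omega>. \<exists>z. (x, z) \<in> R \<omega> ^^ k \<and> (z, y) \<in> R \<omega>)"
    by (intro pred_intros R Suc)
  then show ?case by (rule pred_if_eq) auto
qed simp

text \<open>Gives access to \<open>quot_type.abs_def\<close>, which expresses the abstraction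
  function through the set of equivalent trees. Its value at a graph that is no ordered Family Tree
  is computed from that.\<close>

lemma quot_type_ordered_family_tree_class:
  "quot_type ordered_tree_equiv Abs_ordered_family_tree_class Rep_ordered_family_tree_class"
proof -
  interpret type_definition Rep_ordered_family_tree_class Abs_ordered_family_tree_class
    "{c. \<exists>x. ordered_tree_equiv x x \<and> c = Collect (ordered_tree_equiv x)}"
    by (rule ordered_family_tree_class.type_definition_ordered_family_tree_class)
  show ?thesis
    unfolding quot_type_def
    using ordered_family_tree_class_equivp Rep Rep_inverse Abs_inverse Rep_inject by simp
qed

text \<open>With vertices in \<open>nat\<close>, quantifiers over vertices and over lists of
  vertices are countable, so these four families of events generate all others that are
  needed.\<close>

locale measurable_tree =
  fixes M :: "'a measure" and T :: "'a \<Rightarrow> nat ordered_tree"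
  assumes verts: "\<And>v. Measurable.pred M (\<lambda>\<omega>. v \<in> verts (T \<omega>))"
    and arcs: "\<And>u v. Measurable.pred M (\<lambda>\<omega>. (u, v) \<in> arcs (T \<omega>))"
    and origin: "\<And>v. Measurable.pred M (\<lambda>\<omega>. origin (T \<omega>) = v)"
    and sib: "\<And>u v. Measurable.pred M (\<lambda>\<omega>. (u, v) \<in> sib (T \<omega>))"
begin

lemma adj: "Measurable.pred M (\<lambda>\<omega>. (u, v) \<in> adj (T \<omega>))"
proof -
  have "Measurable.pred M (\<lambda>\<omega>. (u, v) \<in> arcs (T \<omega>) \<or> (v, u) \<in> arcs (T \<omega>))" by (intro pred_intros verts arcs origin sib)
  then show ?thesis by (rule pred_if_eq) (simp add: adj_def)
qed

lemma ball_verts: "Measurable.pred M (\<lambda>\<omega>. v \<in> ball_verts r (T \<omega>))"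
proof -
  have "Measurable.pred M (\<lambda>\<omega>. \<exists>k u. k \<le> r \<and> origin (T \<omega>) = u \<and> (u, v) \<in> adj (T \<omega>) ^^ k)"
    by (intro pred_intros verts arcs origin sib pred_relpow[OF adj])
  then show ?thesis by (rule pred_if_eq) (auto simp: ball_verts_def)
qed

lemma pred_ball_code: "Measurable.pred M (\<lambda>\<omega>. ball_code r (T \<omega>) c)"
proof -
  obtain n m E R where c: "c = (n, m, E, R)" by (cases c)
  have "Measurable.pred M (\<lambda>\<omega>. \<exists>xs. length xs = n \<and> distinct xs \<and>
      (\<forall>v. v \<in> set xs \<longleftrightarrow> v \<in> ball_verts r (T \<omega>)) \<and> m < n \<and> origin (T \<omega>) = xs ! m \<and>
       (\<forall>i j. i < n \<longrightarrow> j < n \<longrightarrow> ((xs ! i, xs ! j) \<in> arcs (T \<omega>) \<longleftrightarrow> (i, j) \<in> set E)) \<and>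
       (\<forall>i j. i < n \<longrightarrow> j < n \<longrightarrow> ((xs ! i, xs ! j) \<in> sib (T \<omega>) \<longleftrightarrow> (i, j) \<in> set R)))"
    by (intro pred_intros verts arcs origin sib ball_verts)
  moreover have "ball_code r (T \<omega>) c \<longleftrightarrow> (\<exists>xs. length xs = n \<and> distinct xs \<and>
      (\<forall>v. v \<in> set xs \<longleftrightarrow> v \<in> ball_verts r (T \<omega>)) \<and> m < n \<and> origin (T \<omega>) = xs ! m \<and>
       (\<forall>i j. i < n \<longrightarrow> j < n \<longrightarrow> ((xs ! i, xs ! j) \<in> arcs (T \<omega>) \<longleftrightarrow> (i, j) \<in> set E)) \<and>
       (\<forall>i j. i < n \<longrightarrow> j < n \<longrightarrow> ((xs ! i, xs ! j) \<in> sib (T \<omega>) \<longleftrightarrow> (i, j) \<in> set R)))" for \<omega>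
    unfolding ball_code_def c prod.case set_eq_iff eq_commute[of "origin (T \<omega>)"] by blast
  ultimately show ?thesis by (rule pred_if_eq)
qed

lemma family_tree: "Measurable.pred M (\<lambda>\<omega>. family_tree (T \<omega>))"
proof -
  have "Measurable.pred M (\<lambda>\<omega>. (x, y) \<in> adj (T \<omega>) \<and> (x, y) \<notin> {(u, v), (v, u)})" for x y u v
    by (intro pred_intros adj)
  then have "Measurable.pred M (\<lambda>\<omega>. (x, y) \<in> adj (T \<omega>) - {(u, v), (v, u)})" for x y u v
    by (rule pred_if_eq) blast
  note * = pred_relpow[OF this]
  \<comment> \<open>Reflexive-transitive closures become existential quantifiers over powers, and
    finiteness of a set of natural numbers becomes the existence of a bound.\<close>
  have "Measurable.pred M (\<lambda>\<omega>. (\<exists>v. origin (T \<omega>) = v \<and> v \<in> verts (T \<omega>)) \<and>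
    (\<forall>u v. (u, v) \<in> arcs (T \<omega>) \<longrightarrow> u \<in> verts (T \<omega>) \<and> v \<in> verts (T \<omega>)) \<and>
    (\<forall>x y z. (x, y) \<in> arcs (T \<omega>) \<longrightarrow> (x, z) \<in> arcs (T \<omega>) \<longrightarrow> y = z) \<and>
    (\<forall>v. v \<in> verts (T \<omega>) \<longrightarrow> (\<exists>N. \<forall>u. (u, v) \<in> adj (T \<omega>) \<longrightarrow> u < N)) \<and>
    (\<forall>u v. u \<in> verts (T \<omega>) \<longrightarrow> v \<in> verts (T \<omega>) \<longrightarrow> (\<exists>k. (u, v) \<in> adj (T \<omega>) ^^ k)) \<and>
    (\<forall>u v. (u, v) \<in> arcs (T \<omega>) \<longrightarrow> \<not> (\<exists>k. (u, v) \<in> (adj (T \<omega>) - {(u, v), (v, u)}) ^^ k)))"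
    by (intro pred_intros verts arcs origin sib pred_relpow[OF adj] adj *)
  moreover have "family_tree (T \<omega>) \<longleftrightarrow> (\<exists>v. origin (T \<omega>) = v \<and> v \<in> verts (T \<omega>)) \<and>
    (\<forall>u v. (u, v) \<in> arcs (T \<omega>) \<longrightarrow> u \<in> verts (T \<omega>) \<and> v \<in> verts (T \<omega>)) \<and>
    (\<forall>x y z. (x, y) \<in> arcs (T \<omega>) \<longrightarrow> (x, z) \<in> arcs (T \<omega>) \<longrightarrow> y = z) \<and>
    (\<forall>v. v \<in> verts (T \<omega>) \<longrightarrow> (\<exists>N. \<forall>u. (u, v) \<in> adj (T \<omega>) \<longrightarrow> u < N)) \<and>
    (\<forall>u v. u \<in> verts (T \<omega>) \<longrightarrow> v \<in> verts (T \<omega>) \<longrightarrow> (\<exists>k. (u, v) \<in> adj (T \<omega>) ^^ k)) \<and>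
    (\<forall>u v. (u, v) \<in> arcs (T \<omega>) \<longrightarrow> \<not> (\<exists>k. (u, v) \<in> (adj (T \<omega>) - {(u, v), (v, u)}) ^^ k))" for \<omega>
    unfolding family_tree_def rtrancl_power finite_nat_set_iff_bounded single_valued_def
    by (intro conj_cong) auto
  ultimately show ?thesis by (rule pred_if_eq)
qed

lemma ordered_family_tree: "Measurable.pred M (\<lambda>\<omega>. ordered_family_tree (T \<omega>))"
proof -
  have "Measurable.pred M (\<lambda>\<omega>. family_tree (T \<omega>) \<and>
    (\<forall>x y. (x, y) \<in> sib (T \<omega>) \<longrightarrow>
      (\<exists>v. v \<in> verts (T \<omega>) \<and> (x, v) \<in> arcs (T \<omega>) \<and> (y, v) \<in> arcs (T \<omega>))) \<and>
    (\<forall>v. v \<in> verts (T \<omega>) \<longrightarrow>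
      (\<forall>x y z. (x, y) \<in> sib (T \<omega>) \<longrightarrow> (y, z) \<in> sib (T \<omega>) \<longrightarrow>
         (x, v) \<in> arcs (T \<omega>) \<longrightarrow> (y, v) \<in> arcs (T \<omega>) \<longrightarrow> (z, v) \<in> arcs (T \<omega>) \<longrightarrow> (x, z) \<in> sib (T \<omega>)) \<and>
      (\<forall>x. (x, v) \<in> arcs (T \<omega>) \<longrightarrow> (x, x) \<notin> sib (T \<omega>)) \<and>
      (\<forall>x y. (x, v) \<in> arcs (T \<omega>) \<longrightarrow> (y, v) \<in> arcs (T \<omega>) \<longrightarrow> x \<noteq> y \<longrightarrow>
         (x, y) \<in> sib (T \<omega>) \<or> (y, x) \<in> sib (T \<omega>))))"
    by (intro pred_intros verts arcs origin sib family_tree)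
  moreover have "ordered_family_tree (T \<omega>) \<longleftrightarrow> family_tree (T \<omega>) \<and>
    (\<forall>x y. (x, y) \<in> sib (T \<omega>) \<longrightarrow>
      (\<exists>v. v \<in> verts (T \<omega>) \<and> (x, v) \<in> arcs (T \<omega>) \<and> (y, v) \<in> arcs (T \<omega>))) \<and>
    (\<forall>v. v \<in> verts (T \<omega>) \<longrightarrow>
      (\<forall>x y z. (x, y) \<in> sib (T \<omega>) \<longrightarrow> (y, z) \<in> sib (T \<omega>) \<longrightarrow>
         (x, v) \<in> arcs (T \<omega>) \<longrightarrow> (y, v) \<in> arcs (T \<omega>) \<longrightarrow> (z, v) \<in> arcs (T \<omega>) \<longrightarrow> (x, z) \<in> sib (T \<omega>)) \<and>
      (\<forall>x. (x, v) \<in> arcs (T \<omega>) \<longrightarrow> (x, x) \<notin> sib (T \<omega>)) \<and>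
      (\<forall>x y. (x, v) \<in> arcs (T \<omega>) \<longrightarrow> (y, v) \<in> arcs (T \<omega>) \<longrightarrow> x \<noteq> y \<longrightarrow>
         (x, y) \<in> sib (T \<omega>) \<or> (y, x) \<in> sib (T \<omega>)))" for \<omega>
  proof -
    have e: "strict_linear_order_on (children T v) (Restr (sib T) (children T v)) \<longleftrightarrow>
      (\<forall>x y z. (x, y) \<in> sib T \<longrightarrow> (y, z) \<in> sib T \<longrightarrow>
         (x, v) \<in> arcs T \<longrightarrow> (y, v) \<in> arcs T \<longrightarrow> (z, v) \<in> arcs T \<longrightarrow> (x, z) \<in> sib T) \<and>
      (\<forall>x. (x, v) \<in> arcs T \<longrightarrow> (x, x) \<notin> sib T) \<and>
      (\<forall>x y. (x, v) \<in> arcs T \<longrightarrow> (y, v) \<in> arcs T \<longrightarrow> x \<noteq> y \<longrightarrow>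
         (x, y) \<in> sib T \<or> (y, x) \<in> sib T)" for T :: "nat ordered_tree" and v
      unfolding strict_linear_order_on_def trans_def irrefl_def total_on_def children_def
      by auto
    have s: "sib T \<subseteq> (\<Union>v\<in>verts T. children T v \<times> children T v) \<longleftrightarrow>
      (\<forall>x y. (x, y) \<in> sib T \<longrightarrow> (\<exists>v. v \<in> verts T \<and> (x, v) \<in> arcs T \<and> (y, v) \<in> arcs T))"
      for T :: "nat ordered_tree"
      unfolding children_def by auto
    show ?thesis unfolding ordered_family_tree_def e s Ball_def ..
  qed
  ultimately show ?thesis by (rule pred_if_eq)
qed

text \<open>Off the family trees, \<open>abs_ordered_family_tree_class\<close> takes a single junk value.\<close>

lemma borel_measurable_abs: "(\<lambda>\<omega>. abs_ordered_family_tree_class (T \<omega>)) \<in> borel_measurable M"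
proof (rule borel_measurable_if_ball_codes)
  fix r c
  define junk where "junk = Abs_ordered_family_tree_class {}"
  have junk: "abs_ordered_family_tree_class S = junk" if "\<not> ordered_family_tree S" for S
  proof -
    have e: "Collect (ordered_tree_equiv S) = {}" using that by (auto simp: ordered_tree_equiv_def)
    show ?thesis
      unfolding junk_def abs_ordered_family_tree_class_def
        quot_type.abs_def[OF quot_type_ordered_family_tree_class] e ..
  qed
  have "Measurable.pred M (\<lambda>\<omega>. ordered_family_tree (T \<omega>) \<and> ball_code r (T \<omega>) c
      \<or> \<not> ordered_family_tree (T \<omega>) \<and> class_ball_code r junk c)"
    by (intro pred_intros verts arcs origin sib ordered_family_tree pred_ball_code)
  moreover have "class_ball_code r (abs_ordered_family_tree_class (T \<omega>)) c \<longleftrightarrow>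
      ordered_family_tree (T \<omega>) \<and> ball_code r (T \<omega>) c
      \<or> \<not> ordered_family_tree (T \<omega>) \<and> class_ball_code r junk c" for \<omega>
    using class_ball_code_abs junk by metis
  ultimately show "Measurable.pred M (\<lambda>\<omega>. class_ball_code r (abs_ordered_family_tree_class (T \<omega>)) c)"
    by (rule pred_if_eq)
qed

end

section \<open>Relabelling\<close>

lemma relabel_simps [simp]:
  "verts (relabel f T) = f ` verts T" "arcs (relabel f T) = map_prod f f ` arcs T"
  "origin (relabel f T) = f (origin T)" "sib (relabel f T) = map_prod f f ` sib T"
  by (simp_all add: relabel_def)

lemma adj_relabel: "adj (relabel f T) = map_prod f f ` adj T"
  by (force simp: adj_def)

text \<open>A path in the image is lifted step by step; injectivity ensures that the lift of one
  step ends where the lift of the next begins.\<close>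

lemma rtrancl_map_prod:
  assumes "inj f"
  shows "(f u, f v) \<in> (map_prod f f ` R)\<^sup>* \<longleftrightarrow> (u, v) \<in> R\<^sup>*"
proof
  have "\<exists>v. y = f v \<and> (u, v) \<in> R\<^sup>*" if "(f u, y) \<in> (map_prod f f ` R)\<^sup>*" for y
    using that
  proof induction
    case (step y z)
    then obtain v where v: "y = f v" "(u, v) \<in> R\<^sup>*" by auto
    obtain a b where ab: "y = f a" "z = f b" "(a, b) \<in> R" using step.hyps(2) by auto
    then have "a = v" using v(1) assms by (simp add: inj_eq)
    then show ?case using v ab by (auto intro: rtrancl_into_rtrancl)
  qed auto
  then show "(f u, f v) \<in> (map_prod f f ` R)\<^sup>* \<Longrightarrow> (u, v) \<in> R\<^sup>*"
    using assms by (metis injD)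
next
  show "(u, v) \<in> R\<^sup>* \<Longrightarrow> (f u, f v) \<in> (map_prod f f ` R)\<^sup>*"
  proof (induction rule: rtrancl_induct)
    case (step y z)
    then have "(f y, f z) \<in> map_prod f f ` R" by (force intro: image_eqI[of _ _ "(y, z)"])
    with step.IH show ?case by (rule rtrancl_into_rtrancl)
  qed simp
qed

lemma map_prod_mem_iff: "inj f \<Longrightarrow> (f u, f v) \<in> map_prod f f ` R \<longleftrightarrow> (u, v) \<in> R"
  using inj_image_mem_iff[OF prod.inj_map, of f f "(u, v)" R] by simp

lemma is_ordered_iso_relabel: "inj f \<Longrightarrow> is_ordered_iso f T (relabel f T)"
  by (simp add: is_ordered_iso_def is_iso_def map_prod_mem_iff inj_on_imp_bij_betw inj_on_subset)

lemma children_relabel: "inj f \<Longrightarrow> children (relabel f T) (f v) = f ` children T v"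
  by (auto simp: children_def inj_eq)

lemma family_tree_relabel:
  assumes "inj f" "family_tree T"
  shows "family_tree (relabel f T)"
  unfolding family_tree_def
proof (intro conjI ballI)
  show "origin (relabel f T) \<in> verts (relabel f T)"
    "arcs (relabel f T) \<subseteq> verts (relabel f T) \<times> verts (relabel f T)"
    using assms(2) by (auto simp: family_tree_def)
  show "single_valued (arcs (relabel f T))"
    using assms by (auto simp: family_tree_def single_valued_def inj_eq)
next
  fix v assume "v \<in> verts (relabel f T)"
  then obtain x where x: "v = f x" "x \<in> verts T" by auto
  have "{u. (u, v) \<in> adj (relabel f T)} = f ` {u. (u, x) \<in> adj T}"
    using assms(1) by (auto simp: adj_relabel x(1) inj_eq)
  then show "finite {u. (u, v) \<in> adj (relabel f T)}"
    using assms(2) x(2) by (simp add: family_tree_def)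
next
  fix u v assume "u \<in> verts (relabel f T)" "v \<in> verts (relabel f T)"
  then show "(u, v) \<in> (adj (relabel f T))\<^sup>*"
    using assms by (auto simp: adj_relabel rtrancl_map_prod family_tree_def)
next
  fix e assume "e \<in> arcs (relabel f T)"
  then obtain x y where e: "e = (f x, f y)" "(x, y) \<in> arcs T" by auto
  have "map_prod f f ` adj T - {(f x, f y), (f y, f x)}
      = map_prod f f ` (adj T - {(x, y), (y, x)})"
    using image_set_diff[OF prod.inj_map[OF assms(1) assms(1)], of "adj T" "{(x, y), (y, x)}"]
    by simp
  then show "case e of (u, v) \<Rightarrow> (u, v) \<notin> (adj (relabel f T) - {(u, v), (v, u)})\<^sup>*"
    using assms e by (auto simp: adj_relabel rtrancl_map_prod family_tree_def)
qed

lemma strict_linear_order_on_map_prod: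
  assumes "inj f" "strict_linear_order_on A R"
  shows "strict_linear_order_on (f ` A) (map_prod f f ` R)"
  unfolding strict_linear_order_on_def
proof (intro conjI)
  show "trans (map_prod f f ` R)"
  proof (rule transI)
    fix x y z assume xy: "(x, y) \<in> map_prod f f ` R" and yz: "(y, z) \<in> map_prod f f ` R"
    from xy obtain a b where "x = f a" "y = f b" "(a, b) \<in> R" by auto
    moreover from yz obtain c d where "y = f c" "z = f d" "(c, d) \<in> R" by auto
    moreover from calculation have "b = c" using assms(1) by (simp add: inj_eq)
    ultimately have "(a, d) \<in> R" "(x, z) = map_prod f f (a, d)"
      using assms(2) by (auto simp: strict_linear_order_on_def dest: transD)
    then show "(x, z) \<in> map_prod f f ` R" by (metis imageI)
  qed
  show "irrefl (map_prod f f ` R)"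
    using assms by (auto simp: irrefl_def strict_linear_order_on_def inj_eq)
  show "total_on (f ` A) (map_prod f f ` R)"
    using assms unfolding total_on_def strict_linear_order_on_def
    by (auto simp: map_prod_mem_iff)
qed

lemma ordered_family_tree_relabel:
  assumes "inj f" "ordered_family_tree T"
  shows "ordered_family_tree (relabel f T)"
  unfolding ordered_family_tree_def
proof (intro conjI ballI)
  show "family_tree (relabel f T)"
    using assms family_tree_relabel ordered_family_treeD by blast
  have "sib T \<subseteq> (\<Union>v\<in>verts T. children T v \<times> children T v)"
    using assms(2) by (simp add: ordered_family_tree_def)
  then show "sib (relabel f T) \<subseteq> (\<Union>v\<in>verts (relabel f T).
      children (relabel f T) v \<times> children (relabel f T) v)"
    using assms(1) by (fastforce simp: children_relabel)
next
  fix v assume "v \<in> verts (relabel f T)"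
  then obtain x where x: "v = f x" "x \<in> verts T" by auto
  then have "strict_linear_order_on (children T x) (Restr (sib T) (children T x))"
    using assms(2) by (simp add: ordered_family_tree_def)
  moreover have "Restr (sib (relabel f T)) (children (relabel f T) v)
      = map_prod f f ` Restr (sib T) (children T x)"
    using assms(1) by (auto simp: children_relabel x(1) inj_eq)
  ultimately show "strict_linear_order_on (children (relabel f T) v)
      (Restr (sib (relabel f T)) (children (relabel f T) v))"
    using strict_linear_order_on_map_prod[OF assms(1)] by (simp only: children_relabel[OF assms(1)] x(1))
qed

text \<open>The tree \<open>T\<close> may have any vertex type, whereas
  \<open>ordered_tree_equiv\<close> compares trees on \<open>nat\<close> only. The shape fits two
  numberings \<open>A\<close> and \<open>B\<close> of one labelled tree.\<close>

lemma abs_ordered_family_tree_class_eqI: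
  assumes "ordered_family_tree A" "ordered_family_tree B" "origin T \<in> verts T"
    and "is_ordered_iso f T A" "is_ordered_iso g T B"
  shows "abs_ordered_family_tree_class A = abs_ordered_family_tree_class B"
proof -
  have "is_ordered_iso (g \<circ> inv_into (verts T) f) A B"
    by (rule is_ordered_iso_comp[OF is_ordered_iso_inv[OF assms(4,3)] assms(5)])
  then have "ordered_tree_equiv A B" using assms by (auto simp: ordered_tree_equiv_def)
  then show ?thesis by (rule Quotient3_rel_abs[OF Quotient3_ordered_family_tree_class])
qed

lemma ordered_family_tree_to_nat:
  "ordered_family_tree T \<Longrightarrow> ordered_family_tree (relabel to_nat T)"
  by (rule ordered_family_tree_relabel) simp

text \<open>The numbering inside \<open>tree_class\<close> is immaterial: both \<open>to_nat\<close>
  and \<open>to_nat \<circ> f\<close> number the vertices of the same tree \<open>T\<close>.\<close>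

lemma tree_class_relabel:
  fixes f :: "'v::countable \<Rightarrow> 'w::countable"
  assumes "inj f" "ordered_family_tree T"
  shows "tree_class (relabel f T) = tree_class T"
  unfolding tree_class_def
proof (rule abs_ordered_family_tree_class_eqI)
  show "is_ordered_iso (to_nat \<circ> f) T (relabel to_nat (relabel f T))"
    using assms(1) by (intro is_ordered_iso_comp[OF is_ordered_iso_relabel is_ordered_iso_relabel]) simp_all
  show "is_ordered_iso to_nat T (relabel to_nat T)" by (rule is_ordered_iso_relabel) simp
  show "origin T \<in> verts T" using assms(2) by (simp add: ordered_family_tree_def family_tree_def)
qed (intro ordered_family_tree_to_nat ordered_family_tree_relabel assms)+

lemma ordered_parent_shift_tree_class:
  assumes "ordered_family_tree T"
  shows "ordered_parent_shift (tree_class T) = tree_class (move_root T)"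
proof -
  let ?N = "relabel to_nat T"
  have N: "ordered_family_tree ?N" by (rule ordered_family_tree_to_nat[OF assms])
  have iso: "is_ordered_iso to_nat T ?N" by (rule is_ordered_iso_relabel) simp
  have "ordered_parent_shift (tree_class T) = abs_ordered_family_tree_class (move_root ?N)"
    unfolding tree_class_def
    by (rule ordered_parent_shift.abs_eq[OF ordered_tree_equiv_refl[OF N]])
  also have "\<dots> = tree_class (move_root T)"
    unfolding tree_class_def
  proof (rule abs_ordered_family_tree_class_eqI)
    show "is_ordered_iso to_nat (move_root T) (relabel to_nat (move_root T))"
      by (rule is_ordered_iso_relabel) simp
    have "is_iso to_nat (move_root T) (move_root ?N)"
      using iso assms N by (intro move_root_iso) (auto simp: is_ordered_iso_def ordered_family_tree_def)
    then show "is_ordered_iso to_nat (move_root T) (move_root ?N)"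
      using iso unfolding is_ordered_iso_def sib_move_root move_root_simps by blast
    show "origin (move_root T) \<in> verts (move_root T)"
      by (intro family_treeD move_root_family_tree ordered_family_treeD assms)
  qed (intro ordered_family_tree_to_nat move_root_ordered_family_tree assms)+
  finally show ?thesis .
qed

lemma same_ordered_ball_tree_class:
  fixes T T' :: "'v::countable ordered_tree"
  assumes "ordered_family_tree T" "ordered_family_tree T'" "ordered_ball r T = ordered_ball r T'"
  shows "same_ordered_ball r (tree_class T) (tree_class T')"
proof -
  have iso: "is_ordered_iso to_nat (ordered_ball r S) (ordered_ball r (relabel to_nat S))"
    if "ordered_family_tree S" for S :: "'v ordered_tree"
    using family_treeD(1,2)[OF ordered_family_treeD[OF that]]
      family_treeD(1,2)[OF ordered_family_treeD[OF ordered_family_tree_to_nat[OF that]]]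
    by (intro is_ordered_iso_ball is_ordered_iso_relabel) simp_all
  have "\<exists>f. is_ordered_iso f (ordered_ball r (relabel to_nat T)) (ordered_ball r (relabel to_nat T'))"
    using is_ordered_iso_comp[OF is_ordered_iso_inv[OF iso[OF assms(1)]]] iso[OF assms(2)]
      ordered_ball_wf(1) assms(3) by metis
  then show ?thesis
    unfolding tree_class_def
    using assms by (simp add: same_ordered_ball.abs_eq ordered_tree_equiv_refl ordered_family_tree_to_nat)
qed

section \<open>Spine trees\<close>

text \<open>The generation of a label relative to the root: path index minus depth below the path.
  It drops by exactly one at every child step, on and off the path, and so serves both as a height
  that excludes cycles and as a bound on how far down a walk can get.\<close>

definition rank :: "label \<Rightarrow> int" where
  "rank v = fst v - int (length (snd v))"

lemma rank_child [simp]: "rank (child S v i) = rank v - 1"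
  by (auto simp: rank_def child_def split: prod.splits)

lemma rank_le_fst: "rank v \<le> fst v"
  by (simp add: rank_def)

text \<open>Makes parents unique. A child on the path has the empty word and any other child a
  non-empty one, so the two branches of \<open>child\<close> never collide, and in each branch the
  arguments can be read off.\<close>

lemma child_inject [simp]: "child S v i = child S v' i' \<longleftrightarrow> v = v' \<and> i = i'"
  by (cases v; cases v') (auto simp: child_def split: if_splits)

lemma spine_tree_simps [simp]:
  "verts (spine_tree S \<omega>) = labels S \<omega>"
  "origin (spine_tree S \<omega>) = (0, [])"
  by (simp_all add: spine_tree_def)

lemma arcs_spine_tree [simp]:
  "(u, v) \<in> arcs (spine_tree S \<omega>) \<longleftrightarrow> v \<in> labels S \<omega> \<and> (\<exists>i\<in>set (\<omega> v). u = child S v i)"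
  unfolding spine_tree_def by (simp del: split_paired_Ex) blast

lemma sib_spine_tree:
  "(x, y) \<in> sib (spine_tree S \<omega>) \<longleftrightarrow> (\<exists>v\<in>labels S \<omega>. \<exists>a b. a < b \<and> b < length (\<omega> v) \<and>
     x = child S v (\<omega> v ! a) \<and> y = child S v (\<omega> v ! b))"
  unfolding spine_tree_def by (simp del: split_paired_Ex) blast

text \<open>A walk from \<open>u\<close> that avoids the edge to its parent \<open>v\<close> only
  meets descendants of \<open>u\<close>: an upward step from a proper descendant stays below
  \<open>u\<close>, and the only upward step from \<open>u\<close> itself is forbidden. Were
  \<open>v\<close> reached, it would be a descendant of its own child, against the strict growth of
  \<open>h\<close> along arcs.\<close>

lemma not_rtrancl_without_edge:
  fixes h :: "'v \<Rightarrow> int"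
  assumes "single_valued (arcs T)" "\<And>x y. (x, y) \<in> arcs T \<Longrightarrow> h x < h y" "(u, v) \<in> arcs T"
  shows "(u, v) \<notin> (adj T - {(u, v), (v, u)})\<^sup>*"
proof
  have "(x, u) \<in> (arcs T)\<^sup>*" if "(u, x) \<in> (adj T - {(u, v), (v, u)})\<^sup>*" for x
    using that
  proof (induction rule: rtrancl_induct)
    case (step x y)
    then consider "(x, y) \<in> arcs T" "(x, y) \<noteq> (u, v)" | "(y, x) \<in> arcs T" by (auto simp: adj_def)
    then show ?case
    proof cases
      case 1
      then have "x \<noteq> u" using assms(1,3) by (auto simp: single_valued_def)
      then obtain z where "(x, z) \<in> arcs T" "(z, u) \<in> (arcs T)\<^sup>*"
        using step.IH by (meson converse_rtranclE)
      then show ?thesis using 1 assms(1) by (auto simp: single_valued_def)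
    next
      case 2
      then show ?thesis using step.IH by (rule converse_rtrancl_into_rtrancl)
    qed
  qed simp
  moreover assume "(u, v) \<in> (adj T - {(u, v), (v, u)})\<^sup>*"
  ultimately have "(v, u) \<in> (arcs T)\<^sup>*" by blast
  then have "h v \<le> h u"
  proof (induction rule: rtrancl_induct)
    case (step y z)
    then show ?case using assms(2)[of y z] by simp
  qed simp
  then show False using assms(2,3) by force
qed

lemma single_valued_finite_successors:
  assumes "single_valued R" shows "finite {v. (u, v) \<in> R}"
proof (cases "\<exists>v. (u, v) \<in> R")
  case True
  then obtain v where "(u, v) \<in> R" by blast
  then have "{v. (u, v) \<in> R} \<subseteq> {v}" using assms by (auto simp: single_valued_def)
  then show ?thesis by (rule finite_subset) simp
qed simp

text \<open>The conditions on the offspring that hold almost surely. The index required in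
  \<open>S\<close> is \<open>1\<close> and not \<open>0\<close>, because the root of
  \<open>EGWT\<close> has unbiased offspring; the root still occurs, as the child of index
  \<open>0\<close> of \<open>(1, [])\<close>, by \<open>zero\<close>.\<close>

locale spine =
  fixes S :: "int set" and \<omega> :: "label \<Rightarrow> nat list"
  assumes one_mem: "1 \<in> S" and Suc_mem: "\<And>n. n \<in> S \<Longrightarrow> n + 1 \<in> S"
    and distinct: "\<And>v. distinct (\<omega> v)" and zero: "\<And>n. n \<in> S \<Longrightarrow> 0 \<in> set (\<omega> (n, []))"
begin

lemma spine_arc:
  assumes "n + 1 \<in> S"
  shows "((n, []), (n + 1, [])) \<in> arcs (spine_tree S \<omega>)"
proof -
  have "child S (n + 1, []) 0 = (n, [])" using assms by (simp add: child_def)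
  then show ?thesis using labels.spine[OF assms] zero[OF assms] by force
qed

lemma origin_label: "(0, []) \<in> labels S \<omega>"
  using labels.child[OF labels.spine[OF one_mem], of 0 \<omega>] zero[OF one_mem] one_mem
  by (simp add: child_def)

lemma single_valued_arcs: "single_valued (arcs (spine_tree S \<omega>))"
  by (auto simp: single_valued_def)

lemma spine_path: "n \<in> S \<Longrightarrow> ((n, []), (n + int k, [])) \<in> (arcs (spine_tree S \<omega>))\<^sup>* \<and> n + int k \<in> S"
proof (induction k)
  case (Suc k)
  then show ?case using spine_arc[of "n + int k"] Suc_mem[of "n + int k"]
    by (auto intro: rtrancl_into_rtrancl simp: ac_simps simp del: arcs_spine_tree)
qed simp

lemma spine_connected: "n \<in> S \<Longrightarrow> ((n, []), (1, [])) \<in> (adj (spine_tree S \<omega>))\<^sup>*"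
proof -
  assume n: "n \<in> S"
  have sub: "(arcs (spine_tree S \<omega>))\<^sup>* \<subseteq> (adj (spine_tree S \<omega>))\<^sup>*"
    by (rule rtrancl_mono) (auto simp: adj_def)
  show ?thesis
  proof (cases "n \<le> 1")
    case True
    then show ?thesis using spine_path[OF n, of "nat (1 - n)"] sub by auto
  next
    case False
    then have "((1, []), (n, [])) \<in> (adj (spine_tree S \<omega>))\<^sup>*"
      using spine_path[OF one_mem, of "nat (n - 1)"] sub by auto
    then show ?thesis by (rule rtrancl_adj_sym)
  qed
qed

lemma label_connected: "v \<in> labels S \<omega> \<Longrightarrow> (v, (1, [])) \<in> (adj (spine_tree S \<omega>))\<^sup>*"
proof (induction rule: labels.induct)
  case (child v i)
  then have "(child S v i, v) \<in> adj (spine_tree S \<omega>)" by (auto simp: adj_def)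
  then show ?case using child.IH by (rule converse_rtrancl_into_rtrancl)
qed (rule spine_connected)

lemma family_tree_spine_tree: "family_tree (spine_tree S \<omega>)"
  unfolding family_tree_def
proof (intro conjI ballI)
  let ?T = "spine_tree S \<omega>"
  show "origin ?T \<in> verts ?T" using origin_label by simp
  show "arcs ?T \<subseteq> verts ?T \<times> verts ?T" by (auto simp: labels.child)
  show "single_valued (arcs ?T)" by (rule single_valued_arcs)
next
  let ?T = "spine_tree S \<omega>"
  fix v
  have "{u. (u, v) \<in> adj ?T} \<subseteq> child S v ` set (\<omega> v) \<union> {u. (v, u) \<in> arcs ?T}"
    by (auto simp: adj_def)
  then show "finite {u. (u, v) \<in> adj ?T}"
    by (rule finite_subset) (simp add: single_valued_finite_successors[OF single_valued_arcs] del: arcs_spine_tree)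
next
  let ?T = "spine_tree S \<omega>"
  fix u v assume "u \<in> verts ?T" "v \<in> verts ?T"
  then have "(u, (1, [])) \<in> (adj ?T)\<^sup>*" "((1, []), v) \<in> (adj ?T)\<^sup>*"
    using label_connected rtrancl_adj_sym[OF label_connected] by simp_all
  then show "(u, v) \<in> (adj ?T)\<^sup>*" by (rule rtrancl_trans)
next
  let ?T = "spine_tree S \<omega>"
  have "rank x < rank y" if "(x, y) \<in> arcs ?T" for x y
    using that by auto
  then show "case e of (u, v) \<Rightarrow> (u, v) \<notin> (adj ?T - {(u, v), (v, u)})\<^sup>*" if "e \<in> arcs ?T" for e
    using not_rtrancl_without_edge[OF single_valued_arcs, of rank "fst e" "snd e"] that
    by (simp only: split_beta prod.collapse) blast
qed

lemma children_spine_tree: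
  "v \<in> labels S \<omega> \<Longrightarrow> children (spine_tree S \<omega>) v = (\<lambda>a. child S v (\<omega> v ! a)) ` {..<length (\<omega> v)}"
  by (force simp: children_def in_set_conv_nth)

text \<open>As \<open>\<omega> v\<close> is distinct, a child determines its position in the list,
  so the sibling order is the order of positions.\<close>

lemma sib_child_iff:
  assumes "v \<in> labels S \<omega>" "a < length (\<omega> v)" "b < length (\<omega> v)"
  shows "(child S v (\<omega> v ! a), child S v (\<omega> v ! b)) \<in> sib (spine_tree S \<omega>) \<longleftrightarrow> a < b"
proof -
  have "c = a \<and> d = b"
    if "\<omega> v ! a = \<omega> v ! c" "\<omega> v ! b = \<omega> v ! d" "c < d" "d < length (\<omega> v)" for c d
    using that assms(2,3) by (simp add: nth_eq_iff_index_eq[OF distinct])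
  then show ?thesis using assms by (auto simp: sib_spine_tree)
qed

lemma ordered_family_tree_spine_tree: "ordered_family_tree (spine_tree S \<omega>)"
  unfolding ordered_family_tree_def
proof (intro conjI ballI family_tree_spine_tree)
  let ?T = "spine_tree S \<omega>"
  show "sib ?T \<subseteq> (\<Union>v\<in>verts ?T. children ?T v \<times> children ?T v)"
    by (fastforce simp: children_def sib_spine_tree)
  fix v assume "v \<in> verts ?T"
  then have v: "v \<in> labels S \<omega>" by simp
  have mem: "(child S v (\<omega> v ! a), child S v (\<omega> v ! b)) \<in> Restr (sib ?T) (children ?T v) \<longleftrightarrow> a < b"
    if "a < length (\<omega> v)" "b < length (\<omega> v)" for a b
    using sib_child_iff[OF v that] that by (simp add: children_spine_tree[OF v])
  have sub: "\<exists>a b. x = child S v (\<omega> v ! a) \<and> y = child S v (\<omega> v ! b) \<and>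
      a < length (\<omega> v) \<and> b < length (\<omega> v)"
    if "(x, y) \<in> Restr (sib ?T) (children ?T v)" for x y
    using that unfolding children_spine_tree[OF v] by auto
  show "strict_linear_order_on (children ?T v) (Restr (sib ?T) (children ?T v))"
    (is "strict_linear_order_on _ ?R")
    unfolding strict_linear_order_on_def
  proof (intro conjI)
    show "trans ?R"
    proof (rule transI)
      fix x y z assume xy: "(x, y) \<in> ?R" and yz: "(y, z) \<in> ?R"
      obtain a b where ab: "x = child S v (\<omega> v ! a)" "y = child S v (\<omega> v ! b)"
        "a < length (\<omega> v)" "b < length (\<omega> v)" using sub[OF xy] by blast
      obtain c where c: "z = child S v (\<omega> v ! c)" "c < length (\<omega> v)" using sub[OF yz] by blast
      have "a < b" "b < c" using xy yz mem ab c by blast+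
      then show "(x, z) \<in> ?R" using mem ab c less_trans by blast
    qed
    show "irrefl ?R"
      unfolding irrefl_def using sub mem by blast
    show "total_on (children ?T v) ?R"
    proof (rule total_onI)
      fix x y assume "x \<in> children ?T v" "y \<in> children ?T v" and ne: "x \<noteq> y"
      then obtain a b where ab: "x = child S v (\<omega> v ! a)" "y = child S v (\<omega> v ! b)"
        "a < length (\<omega> v)" "b < length (\<omega> v)" unfolding children_spine_tree[OF v] by auto
      then have "a < b \<or> b < a" using ne by (metis linorder_cases)
      then show "(x, y) \<in> ?R \<or> (y, x) \<in> ?R" using mem ab by blast
    qed
  qed
qed

end

section \<open>Locality: balls depend only on labels of high rank\<close>

definition agree_above ::
    "int \<Rightarrow> int set \<Rightarrow> (label \<Rightarrow> 'b) \<Rightarrow> int set \<Rightarrow> (label \<Rightarrow> 'b) \<Rightarrow> bool" where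
  "agree_above l S \<omega> S' \<omega>' \<longleftrightarrow>
     (\<forall>n\<ge>l. n \<in> S \<longleftrightarrow> n \<in> S') \<and> (\<forall>v. l \<le> fst v \<longrightarrow> \<omega> v = \<omega>' v)"

lemma agree_above_sym: "agree_above l S \<omega> S' \<omega>' \<Longrightarrow> agree_above l S' \<omega>' S \<omega>"
  by (simp add: agree_above_def)

lemma agree_above_child:
  assumes "agree_above l S \<omega> S' \<omega>'" "l \<le> rank v"
  shows "child S v i = child S' v i" "\<omega> v = \<omega>' v"
  using assms rank_le_fst[of v] by (cases v; auto simp: child_def agree_above_def)+

text \<open>Whether a label occurs is decided by its ancestors, which have larger rank, so its
  derivation never leaves the region of agreement. That region is described by first coordinates and
  covers these labels because \<open>rank v \<le> fst v\<close>.\<close>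

lemma labels_local:
  assumes "v \<in> labels S \<omega>" "l \<le> rank v" "agree_above l S \<omega> S' \<omega>'"
  shows "v \<in> labels S' \<omega>'"
  using assms(1,2)
proof induction
  case (spine n)
  then show ?case using assms(3) by (auto simp: rank_def agree_above_def intro: labels.spine)
next
  case (child v i)
  then have l: "l \<le> rank v" by simp
  note * = agree_above_child[OF assms(3) l]
  show ?case using child.IH[OF l] child.hyps(2) *(2) unfolding *(1) by (simp add: labels.child)
qed

lemma spine_tree_local:
  assumes "agree_above l S \<omega> S' \<omega>'" "l \<le> rank x" "l \<le> rank y"
  shows "(x, y) \<in> arcs (spine_tree S \<omega>) \<Longrightarrow> (x, y) \<in> arcs (spine_tree S' \<omega>')"
    and "(x, y) \<in> sib (spine_tree S \<omega>) \<Longrightarrow> (x, y) \<in> sib (spine_tree S' \<omega>')"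
proof -
  show "(x, y) \<in> arcs (spine_tree S' \<omega>')" if "(x, y) \<in> arcs (spine_tree S \<omega>)"
    using that labels_local[OF _ assms(3,1)] agree_above_child[OF assms(1,3)] by simp
  show "(x, y) \<in> sib (spine_tree S' \<omega>')" if "(x, y) \<in> sib (spine_tree S \<omega>)"
  proof -
    obtain v a b where v: "v \<in> labels S \<omega>" "a < b" "b < length (\<omega> v)"
      "x = child S v (\<omega> v ! a)" "y = child S v (\<omega> v ! b)"
      using \<open>(x, y) \<in> sib (spine_tree S \<omega>)\<close> by (auto simp: sib_spine_tree)
    have l: "l \<le> rank v" using assms(2) v(4) by simp
    note * = agree_above_child[OF assms(1) l]
    show ?thesis using labels_local[OF v(1) l assms(1)] v(2-5) unfolding * sib_spine_tree by blast
  qed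
qed

text \<open>The root has rank 0, and crossing an arc in either direction changes the rank by
  one.\<close>

lemma rank_walk:
  "((0, []), v) \<in> adj (spine_tree S \<omega>) ^^ k \<Longrightarrow> - int k \<le> rank v"
proof (induction k arbitrary: v)
  case 0
  then show ?case by (auto simp: rank_def)
next
  case (Suc k)
  then obtain u where u: "((0, []), u) \<in> adj (spine_tree S \<omega>) ^^ k" "(u, v) \<in> adj (spine_tree S \<omega>)"
    by auto
  then show ?case using Suc.IH[OF u(1)] by (auto simp: adj_def)
qed

lemma rank_ball_verts: "v \<in> ball_verts r (spine_tree S \<omega>) \<Longrightarrow> - int r \<le> rank v"
  unfolding ball_verts_def spine_tree_simps using rank_walk by fastforce

lemma ball_verts_spine_tree_local:
  assumes "agree_above (- int r) S \<omega> S' \<omega>'"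
  shows "ball_verts r (spine_tree S \<omega>) \<subseteq> ball_verts r (spine_tree S' \<omega>')"
proof -
  have "((0, []), v) \<in> adj (spine_tree S' \<omega>') ^^ k"
    if "((0, []), v) \<in> adj (spine_tree S \<omega>) ^^ k" "k \<le> r" for k v
    using that
  proof (induction k arbitrary: v)
    case (Suc k)
    then obtain u where u: "((0, []), u) \<in> adj (spine_tree S \<omega>) ^^ k" "(u, v) \<in> adj (spine_tree S \<omega>)"
      by auto
    have "- int r \<le> rank u" "- int r \<le> rank v"
      using rank_walk[OF u(1)] rank_walk[OF Suc.prems(1)] Suc.prems(2) by linarith+
    then have "(u, v) \<in> adj (spine_tree S' \<omega>')"
      using u(2) spine_tree_local(1)[OF assms] unfolding adj_def by blast
    then show ?case using Suc.IH[OF u(1)] Suc.prems by auto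
  qed simp
  then show ?thesis unfolding ball_verts_def spine_tree_simps by blast
qed

lemma ordered_ball_spine_tree_local:
  assumes "agree_above (- int r) S \<omega> S' \<omega>'"
  shows "ordered_ball r (spine_tree S \<omega>) = ordered_ball r (spine_tree S' \<omega>')"
proof -
  let ?T = "spine_tree S \<omega>" and ?T' = "spine_tree S' \<omega>'"
  note assms' = agree_above_sym[OF assms]
  have B: "ball_verts r ?T = ball_verts r ?T'"
    using ball_verts_spine_tree_local[OF assms] ball_verts_spine_tree_local[OF assms'] by blast
  have eq: "Restr R (ball_verts r ?T') = Restr R' (ball_verts r ?T')"
    if "\<And>x y. - int r \<le> rank x \<Longrightarrow> - int r \<le> rank y \<Longrightarrow> (x, y) \<in> R \<longleftrightarrow> (x, y) \<in> R'" for R R'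
    using that rank_ball_verts by blast
  have "Restr (arcs ?T) (ball_verts r ?T') = Restr (arcs ?T') (ball_verts r ?T')"
    by (rule eq) (blast intro: spine_tree_local(1)[OF assms] spine_tree_local(1)[OF assms'])
  moreover have "Restr (sib ?T) (ball_verts r ?T') = Restr (sib ?T') (ball_verts r ?T')"
    by (rule eq) (blast intro: spine_tree_local(2)[OF assms] spine_tree_local(2)[OF assms'])
  ultimately show ?thesis
    unfolding ordered_ball_def tree_ball_def B by (simp add: spine_tree_def)
qed

section \<open>Translation along the distinguished path\<close>

definition shift :: "int \<Rightarrow> (label \<Rightarrow> 'b) \<Rightarrow> label \<Rightarrow> 'b" where
  "shift k \<omega> = (\<lambda>(n, w). \<omega> (n + k, w))"

definition shift_label :: "int \<Rightarrow> label \<Rightarrow> label" where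
  "shift_label k = (\<lambda>(n, w). (n + k, w))"

lemma inj_shift_label: "inj (shift_label k)"
  by (auto simp: shift_label_def inj_def)

text \<open>Recentring at the \<open>k\<close>-th path vertex: the label \<open>(n + k, w)\<close>
  is renamed \<open>(n, w)\<close>. The renaming respects children only if the set of size-biased
  indices is translated along with it.\<close>

lemma child_shift_label:
  "child {n. n + k \<in> S} v i = shift_label (- k) (child S (shift_label k v) i)"
  by (auto simp: child_def shift_label_def split: prod.splits)

lemma shift_label_inverse [simp]: "shift_label k (shift_label (- k) v) = v"
   "shift_label (- k) (shift_label k v) = v"
  by (auto simp: shift_label_def split: prod.splits)

lemma shift_label_eq_iff: "x = shift_label (- k) y \<longleftrightarrow> shift_label k x = y"
  by auto

lemma shift_apply: "shift k \<omega> v = \<omega> (shift_label k v)"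
  by (auto simp: shift_def shift_label_def split: prod.splits)

lemma shift_label_labels:
  assumes "v \<in> labels S \<omega>"
  shows "shift_label (- k) v \<in> labels {n. n + k \<in> S} (shift k \<omega>)"
  using assms
proof induction
  case (spine n)
  then show ?case by (auto simp: shift_label_def intro: labels.spine)
next
  case (child v i)
  have "child {n. n + k \<in> S} (shift_label (- k) v) i \<in> labels {n. n + k \<in> S} (shift k \<omega>)"
    using child.hyps(2) by (intro labels.child[OF child.IH]) (simp add: shift_apply)
  then show ?case by (simp add: child_shift_label)
qed

lemma labels_shift:
  "labels {n. n + k \<in> S} (shift k \<omega>) = shift_label (- k) ` labels S \<omega>"
proof
  show "labels {n. n + k \<in> S} (shift k \<omega>) \<subseteq> shift_label (- k) ` labels S \<omega>"
  proof
    fix v assume "v \<in> labels {n. n + k \<in> S} (shift k \<omega>)"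
    \<comment> \<open>Translating the translated data by \<open>- k\<close> restores the original
      data, so the converse inclusion is an instance of the direct one.\<close>
    from shift_label_labels[OF this, of "- k"] have "shift_label k v \<in> labels S \<omega>"
      by (simp add: shift_def)
    then show "v \<in> shift_label (- k) ` labels S \<omega>" by (metis image_eqI shift_label_inverse(2))
  qed
qed (auto intro: shift_label_labels)

text \<open>Moving the root up amounts to translating the environment: after relabelling, the trees
  are equal and not merely isomorphic. The parent of the old root is \<open>(1, [])\<close>, which
  the translation takes to \<open>(0, [])\<close>.\<close>

lemma (in spine) move_root_spine_tree:
  "relabel (shift_label (- 1)) (move_root (spine_tree S \<omega>)) = spine_tree {n. n + 1 \<in> S} (shift 1 \<omega>)"
proof (rule ordered_tree.equality)
  have "origin (move_root (spine_tree S \<omega>)) = (1, [])"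
    by (rule origin_move_root_eq[OF single_valued_arcs]) (use spine_arc[of 0] one_mem in simp)
  then show "origin (relabel (shift_label (- 1)) (move_root (spine_tree S \<omega>)))
      = origin (spine_tree {n. n + 1 \<in> S} (shift 1 \<omega>))"
    by (simp add: shift_label_def)
  have 1: "(x, y) \<in> map_prod (shift_label (- 1)) (shift_label (- 1)) ` R \<longleftrightarrow>
      (shift_label 1 x, shift_label 1 y) \<in> R" for x y R
    using map_prod_mem_iff[OF inj_shift_label[of "-1"], of "shift_label 1 x" "shift_label 1 y" R]
    by simp
  have 2: "v \<in> labels {n. n + 1 \<in> S} (shift 1 \<omega>) \<longleftrightarrow> shift_label 1 v \<in> labels S \<omega>" for v
    unfolding labels_shift by (auto simp: shift_label_eq_iff)
  show "arcs (relabel (shift_label (- 1)) (move_root (spine_tree S \<omega>)))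
      = arcs (spine_tree {n. n + 1 \<in> S} (shift 1 \<omega>))"
    by (rule set_eqI, unfold split_paired_all)
       (simp add: 1 2 child_shift_label shift_apply shift_label_eq_iff)
  show "sib (relabel (shift_label (- 1)) (move_root (spine_tree S \<omega>)))
      = sib (spine_tree {n. n + 1 \<in> S} (shift 1 \<omega>))"
    by (rule set_eqI, unfold split_paired_all)
       (simp add: 1 sib_spine_tree labels_shift child_shift_label shift_apply shift_label_eq_iff)
qed (simp_all add: labels_shift)

lemma (in spine) spine_shift: "spine {n. n + int k \<in> S} (shift (int k) \<omega>)"
proof
  show "1 \<in> {n. n + int k \<in> S}"
    using spine_path[OF one_mem] by (simp add: ac_simps)
  show "n + 1 \<in> {n. n + int k \<in> S}" if "n \<in> {n. n + int k \<in> S}" for n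
    using that Suc_mem[of "n + int k"] by (simp add: ac_simps)
qed (use distinct zero in \<open>auto simp: shift_def\<close>)

text \<open>For \<open>S = {1..}\<close> the index set after \<open>k\<close> steps is
  \<open>{1 - int k..}\<close>. These sets exhaust the integers, which is how the bi-infinite path
  of the Kesten tree arises from a one-sided one.\<close>

lemma (in spine) ordered_parent_shift_spine_tree:
  "(ordered_parent_shift ^^ k) (tree_class (spine_tree S \<omega>))
    = tree_class (spine_tree {n. n + int k \<in> S} (shift (int k) \<omega>))"
proof (induction k)
  case 0
  then show ?case by (simp add: shift_def)
next
  case (Suc k)
  interpret k: spine "{n. n + int k \<in> S}" "shift (int k) \<omega>" by (rule spine_shift)
  have "(ordered_parent_shift ^^ Suc k) (tree_class (spine_tree S \<omega>))
      = tree_class (move_root (spine_tree {n. n + int k \<in> S} (shift (int k) \<omega>)))"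
    using Suc ordered_parent_shift_tree_class[OF k.ordered_family_tree_spine_tree] by simp
  also have "\<dots> = tree_class (relabel (shift_label (- 1))
      (move_root (spine_tree {n. n + int k \<in> S} (shift (int k) \<omega>))))"
    by (intro tree_class_relabel[symmetric] inj_shift_label move_root_ordered_family_tree
        k.ordered_family_tree_spine_tree)
  also have "\<dots> = tree_class (spine_tree {n. n + 1 \<in> {n. n + int k \<in> S}} (shift 1 (shift (int k) \<omega>)))"
    unfolding k.move_root_spine_tree ..
  also have "shift 1 (shift (int k) \<omega>) = shift (int (Suc k)) \<omega>"
    by (auto simp: shift_def fun_eq_iff ac_simps)
  also have "{n. n + 1 \<in> {n. n + int k \<in> S}} = {n. n + int (Suc k) \<in> S}"
    by (simp add: ac_simps)
  finally show ?case .
qed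

lemma same_ordered_ball_spine_tree:
  assumes "spine S \<omega>" "spine S' \<omega>'" "agree_above (- int r) S \<omega> S' \<omega>'"
  shows "same_ordered_ball r (tree_class (spine_tree S \<omega>)) (tree_class (spine_tree S' \<omega>'))"
  using assms spine.ordered_family_tree_spine_tree ordered_ball_spine_tree_local
  by (intro same_ordered_ball_tree_class)

section \<open>Coupling and convergence\<close>

fun level :: "int set \<Rightarrow> (label \<Rightarrow> nat list) \<Rightarrow> nat \<Rightarrow> label set" where
  "level S \<omega> 0 = {v. snd v = [] \<and> fst v \<in> S}"
| "level S \<omega> (Suc k) = {u. \<exists>v i. v \<in> level S \<omega> k \<and> i \<in> set (\<omega> v) \<and> u = child S v i}"

text \<open>Counting child steps turns the inductive definition of \<open>labels\<close> into a
  countable union, whose members are events by induction on the number of steps.\<close>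

lemma labels_eq_Union_level: "v \<in> labels S \<omega> \<longleftrightarrow> (\<exists>k. v \<in> level S \<omega> k)"
proof
  assume "v \<in> labels S \<omega>"
  then show "\<exists>k. v \<in> level S \<omega> k"
  proof induction
    case (spine n)
    then show ?case by (intro exI[of _ 0]) simp
  next
    case (child v i)
    then obtain k where "v \<in> level S \<omega> k" by blast
    then have "child S v i \<in> level S \<omega> (Suc k)" using child.hyps(2) by (cases v) auto
    then show ?case ..
  qed
next
  have "v \<in> labels S \<omega>" if "v \<in> level S \<omega> k" for k
    using that
  proof (induction k arbitrary: v)
    case 0
    then show ?case using labels.spine[of "fst v" S \<omega>] by (cases v) auto
  next
    case (Suc k)
    then show ?case by (auto simp del: split_paired_Ex intro: labels.child)
  qed
  then show "\<exists>k. v \<in> level S \<omega> k \<Longrightarrow> v \<in> labels S \<omega>" by blast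
qed

lemma pred_coordinate:
  assumes "(\<lambda>\<omega>. \<omega> v) \<in> measurable M (count_space UNIV)"
  shows "Measurable.pred M (\<lambda>\<omega>. P (\<omega> v))"
  using assms by (rule measurable_compose) simp

lemma map_prod_image_iff: "(x, y) \<in> map_prod f g ` R \<longleftrightarrow> (\<exists>a b. (a, b) \<in> R \<and> x = f a \<and> y = g b)"
  by force

lemma measurable_tree_spine_tree:
  assumes coord: "\<And>v. (\<lambda>\<omega>. \<omega> v) \<in> measurable M (count_space UNIV)"
  shows "measurable_tree M (\<lambda>\<omega>. relabel to_nat (spine_tree S \<omega>))"
proof
  have offspring: "Measurable.pred M (\<lambda>\<omega>. i \<in> set (\<omega> v))" for i v
    by (rule pred_coordinate[OF coord])
  have "Measurable.pred M (\<lambda>\<omega>. v \<in> level S \<omega> k)" for v k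
  proof (induction k arbitrary: v)
    case (Suc k)
    have "Measurable.pred M (\<lambda>\<omega>. \<exists>u i. u \<in> level S \<omega> k \<and> i \<in> set (\<omega> u) \<and> v = child S u i)"
      by (intro pred_intros Suc offspring)
    then show ?case by (rule pred_if_eq) (simp del: split_paired_Ex)
  qed (simp add: pred_const)
  then have "Measurable.pred M (\<lambda>\<omega>. \<exists>k. v \<in> level S \<omega> k)" for v
    by (intro pred_intros)
  then have labels: "Measurable.pred M (\<lambda>\<omega>. v \<in> labels S \<omega>)" for v
    unfolding labels_eq_Union_level .
  show "Measurable.pred M (\<lambda>\<omega>. x \<in> verts (relabel to_nat (spine_tree S \<omega>)))" for x
  proof -
    have "Measurable.pred M (\<lambda>\<omega>. \<exists>v. x = to_nat v \<and> v \<in> labels S \<omega>)"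
      by (intro pred_intros labels)
    then show ?thesis by (rule pred_if_eq) auto
  qed
  show "Measurable.pred M (\<lambda>\<omega>. (x, y) \<in> arcs (relabel to_nat (spine_tree S \<omega>)))" for x y
  proof -
    have "Measurable.pred M (\<lambda>\<omega>. \<exists>v i. x = to_nat (child S v i) \<and> y = to_nat v \<and>
        v \<in> labels S \<omega> \<and> i \<in> set (\<omega> v))"
      by (intro pred_intros labels offspring)
    then show ?thesis
      by (rule pred_if_eq) (simp only: relabel_simps map_prod_image_iff arcs_spine_tree, blast)
  qed
  show "Measurable.pred M (\<lambda>\<omega>. origin (relabel to_nat (spine_tree S \<omega>)) = x)" for x
    by simp
  show "Measurable.pred M (\<lambda>\<omega>. (x, y) \<in> sib (relabel to_nat (spine_tree S \<omega>)))" for x y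
  proof -
    \<comment> \<open>Kept in one piece: the whole conjunction depends on \<open>\<omega>\<close>
      only through the discrete coordinate \<open>\<omega> v\<close>, while its parts are not
      membership events.\<close>
    have order: "Measurable.pred M (\<lambda>\<omega>. a < b \<and> b < length (\<omega> v) \<and>
        x = to_nat (child S v (\<omega> v ! a)) \<and> y = to_nat (child S v (\<omega> v ! b)))" for v a b
      by (rule pred_coordinate[OF coord])
    have "Measurable.pred M (\<lambda>\<omega>. \<exists>v a b. v \<in> labels S \<omega> \<and> (a < b \<and> b < length (\<omega> v) \<and>
        x = to_nat (child S v (\<omega> v ! a)) \<and> y = to_nat (child S v (\<omega> v ! b))))"
      by (intro pred_intros(3), rule pred_intros(5)[OF labels order])
    then show ?thesis
      by (rule pred_if_eq) (simp only: relabel_simps map_prod_image_iff sib_spine_tree, blast)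
  qed
qed

lemma borel_measurable_tree_class_spine_tree:
  assumes "\<And>v. (\<lambda>\<omega>. \<omega> v) \<in> measurable M (count_space UNIV)"
  shows "(\<lambda>\<omega>. tree_class (spine_tree S \<omega>)) \<in> borel_measurable M"
  unfolding tree_class_def
  by (rule measurable_tree.borel_measurable_abs[OF measurable_tree_spine_tree[OF assms]])

text \<open>Output \<open>v\<close> is a function of the input \<open>\<sigma> v\<close> alone and
  distinct outputs read distinct inputs, so independence is inherited and only the single marginals
  have to match. Both the \<open>n\<close>-th tree and the limit obtain their law from this.\<close>

lemma distr_PiM_pmf:
  assumes "inj \<sigma>" and g: "\<And>v. map_pmf (g v) (A (\<sigma> v)) = B v"
  shows "distr (\<Pi>\<^sub>M u\<in>UNIV. measure_pmf (A u)) (\<Pi>\<^sub>M v\<in>UNIV. measure_pmf (B v)) (\<lambda>x v. g v (x (\<sigma> v)))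
    = (\<Pi>\<^sub>M v\<in>UNIV. measure_pmf (B v))" (is "distr ?A ?B ?h = _")
proof (rule measure_eqI_PiM_infinite[symmetric, OF refl])
  interpret B: prob_space ?B by (intro prob_space_PiM measure_pmf.prob_space_axioms)
  show "finite_measure ?B" by unfold_locales
  have coord: "(\<lambda>x. g v (x (\<sigma> v))) \<in> measurable ?A (measure_pmf (B v))" for v
    by (rule measurable_compose[OF measurable_component_singleton[of "\<sigma> v"]]) simp_all
  have h: "?h \<in> measurable ?A ?B"
    by (rule measurable_PiM_single') (use coord in \<open>simp_all add: PiE_def\<close>)
  fix X J assume J: "finite J" "J \<subseteq> UNIV" "\<And>v. v \<in> J \<Longrightarrow> X v \<in> sets (measure_pmf (B v))"
  \<comment> \<open>Carries the cylinder \<open>X\<close> over to the inputs: for \<open>u\<close>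
    in the range of \<open>\<sigma>\<close>, the index \<open>the_inv \<sigma> u\<close> is the only
    output that reads \<open>u\<close>.\<close>
  define Y where "Y u = g (the_inv \<sigma> u) -` X (the_inv \<sigma> u)" for u
  have Y: "Y (\<sigma> v) = g v -` X v" for v
    using assms(1) by (simp add: Y_def the_inv_f_f)
  have "emeasure ?B (prod_emb UNIV (\<lambda>v. measure_pmf (B v)) J (Pi\<^sub>E J X))
      = (\<Prod>v\<in>J. emeasure (measure_pmf (B v)) (X v))"
    using J by (intro emeasure_PiM_emb measure_pmf.prob_space_axioms)
  also have "\<dots> = (\<Prod>v\<in>J. emeasure (measure_pmf (A (\<sigma> v))) (Y (\<sigma> v)))"
    by (simp add: Y flip: g)
  also have "\<dots> = (\<Prod>u\<in>\<sigma> ` J. emeasure (measure_pmf (A u)) (Y u))"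
    using assms(1) by (simp add: prod.reindex inj_on_subset)
  also have "\<dots> = emeasure ?A (prod_emb UNIV (\<lambda>u. measure_pmf (A u)) (\<sigma> ` J) (Pi\<^sub>E (\<sigma> ` J) Y))"
    using J by (intro emeasure_PiM_emb[symmetric] measure_pmf.prob_space_axioms) simp_all
  also have "prod_emb UNIV (\<lambda>u. measure_pmf (A u)) (\<sigma> ` J) (Pi\<^sub>E (\<sigma> ` J) Y)
      = ?h -` prod_emb UNIV (\<lambda>v. measure_pmf (B v)) J (Pi\<^sub>E J X) \<inter> space ?A"
    by (auto simp: prod_emb_def space_PiM Y PiE_iff)
  also have "emeasure ?A \<dots> = emeasure (distr ?A ?B ?h) (prod_emb UNIV (\<lambda>v. measure_pmf (B v)) J (Pi\<^sub>E J X))"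
    using J by (intro emeasure_distr[symmetric] h sets_PiM_I) simp_all
  finally show "emeasure ?B (prod_emb UNIV (\<lambda>v. measure_pmf (B v)) J (Pi\<^sub>E J X))
      = emeasure (distr ?A ?B ?h) (prod_emb UNIV (\<lambda>v. measure_pmf (B v)) J (Pi\<^sub>E J X))" .
qed simp

section \<open>Size-biased laws and supports of offspring\<close>

lemma pmf_size_biased:
  assumes "measure_pmf.expectation p real = 1"
  shows "pmf (size_biased p) k = real k * pmf p k"
  unfolding size_biased_def
proof (rule pmf_embed_pmf)
  \<comment> \<open>The integral of a non-integrable function is 0 by convention, so the value 1
    forces integrability.\<close>
  have int: "integrable (measure_pmf p) real"
    using assms not_integrable_integral_eq by fastforce
  have "(\<integral>\<^sup>+ k. ennreal (real k * pmf p k) \<partial>count_space UNIV)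
      = (\<integral>\<^sup>+ k. ennreal (real k) \<partial>measure_pmf p)"
    by (simp add: nn_integral_measure_pmf ennreal_mult' mult.commute)
  also have "\<dots> = ennreal (measure_pmf.expectation p real)"
    by (rule nn_integral_eq_integral[OF int]) simp
  finally show "(\<integral>\<^sup>+ k. ennreal (real k * pmf p k) \<partial>count_space UNIV) = 1"
    using assms by simp
qed simp

lemma set_pmf_offspring:
  "l \<in> set_pmf (offspring q) \<longleftrightarrow> (\<exists>k\<in>set_pmf q. distinct l \<and> set l = {..<k})"
proof -
  have "set_pmf (pmf_of_set (permutations_of_set {..<k})) = permutations_of_set {..<k::nat}" for k
    by (rule set_pmf_of_set) simp_all
  then show ?thesis by (auto simp: offspring_def permutations_of_set_def)
qed

section \<open>Weak convergence and continuous images\<close>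

lemma weakly_converges_if_AE_tendsto:
  fixes X :: "nat \<Rightarrow> 'b \<Rightarrow> 'a::topological_space"
  assumes "prob_space Q" "\<And>n. X n \<in> borel_measurable Q" "Y \<in> borel_measurable Q"
    "AE x in Q. (\<lambda>n. X n x) \<longlonglongrightarrow> Y x"
  shows "weakly_converges (\<lambda>n. distr Q borel (X n)) (distr Q borel Y)"
  unfolding weakly_converges_def
proof (intro conjI allI impI)
  interpret prob_space Q by fact
  show "prob_space (distr Q borel (X n))" "prob_space (distr Q borel Y)" for n
    using assms by (simp_all add: prob_space_distr)
  fix f :: "'a \<Rightarrow> real" assume f: "continuous_on UNIV f \<and> bounded (range f)"
  then have meas: "f \<in> borel_measurable borel" by (simp add: borel_measurable_continuous_onI)
  obtain B where B: "\<And>a. norm (f a) \<le> B" using f by (auto simp: bounded_iff)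
  have "(\<lambda>n. \<integral>x. f (X n x) \<partial>Q) \<longlonglongrightarrow> (\<integral>x. f (Y x) \<partial>Q)"
  proof (rule integral_dominated_convergence[where w = "\<lambda>_. B"])
    show "AE x in Q. (\<lambda>n. f (X n x)) \<longlonglongrightarrow> f (Y x)"
      using assms(4) by eventually_elim (use f in \<open>auto intro: continuous_on_tendsto_compose\<close>)
  qed (use B meas assms in \<open>auto intro: measurable_compose\<close>)
  then show "(\<lambda>n. \<integral>x. f x \<partial>distr Q borel (X n)) \<longlonglongrightarrow> (\<integral>x. f x \<partial>distr Q borel Y)"
    using assms meas by (simp add: integral_distr)
qed simp_all

lemma weakly_converges_continuous_image:
  fixes g :: "'a::topological_space \<Rightarrow> 'b::topological_space"
  assumes "weakly_converges P Q" "continuous_on UNIV g"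
  shows "weakly_converges (\<lambda>n. distr (P n) borel g) (distr Q borel g)"
  unfolding weakly_converges_def
proof (intro conjI allI impI)
  have g: "g \<in> borel_measurable borel" by (rule borel_measurable_continuous_onI[OF assms(2)])
  have P: "sets (P n) = sets borel" "prob_space (P n)" and Q: "sets Q = sets borel" "prob_space Q" for n
    using assms(1) by (auto simp: weakly_converges_def)
  have m: "g \<in> measurable (P n) borel" "g \<in> measurable Q borel" for n
    using g P Q by (simp_all cong: measurable_cong_sets)
  show "prob_space (distr (P n) borel g)" "prob_space (distr Q borel g)" for n
    using P Q m by (simp_all add: prob_space.prob_space_distr)
  fix f :: "'b \<Rightarrow> real" assume f: "continuous_on UNIV f \<and> bounded (range f)"
  then have meas: "f \<in> borel_measurable borel" by (simp add: borel_measurable_continuous_onI)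
  have "continuous_on UNIV (\<lambda>x. f (g x))"
    using f assms(2) continuous_on_compose2 by blast
  moreover have "bounded (range (\<lambda>x. f (g x)))"
    using f by (auto intro: bounded_subset)
  ultimately have "(\<lambda>n. \<integral>x. f (g x) \<partial>P n) \<longlonglongrightarrow> (\<integral>x. f (g x) \<partial>Q)"
    using assms(1) by (simp add: weakly_converges_def)
  then show "(\<lambda>n. \<integral>x. f x \<partial>distr (P n) borel g) \<longlonglongrightarrow> (\<integral>x. f x \<partial>distr Q borel g)"
    using m meas by (simp add: integral_distr)
qed simp_all

lemma continuous_on_funpow:
  "continuous_on UNIV (f :: 'a::topological_space \<Rightarrow> 'a) \<Longrightarrow> continuous_on UNIV (f ^^ n)"
  by (induction n) (auto simp: comp_def intro: continuous_on_compose2)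

text \<open>Since \<open>g\<close> intertwines \<open>F\<close> and \<open>G\<close>, it intertwines
  all their iterates, and the orbit of the image law is the image of the orbit. Used with
  \<open>g = forget_order\<close>.\<close>

lemma is_shift_probability_continuous_image:
  assumes "is_shift_probability F P Q" "sets P = sets borel"
    and "continuous_on UNIV F" "continuous_on UNIV G" "continuous_on UNIV g"
    and comm: "\<And>x. g (F x) = G (g x)"
  shows "is_shift_probability G (distr P borel g) (distr Q borel g)"
proof -
  have "g ((F ^^ n) x) = (G ^^ n) (g x)" for n x
    by (induction n) (simp_all add: comm)
  then have comp: "G ^^ n \<circ> g = g \<circ> F ^^ n" for n by (simp add: fun_eq_iff)
  have m: "g \<in> borel_measurable borel" "G ^^ n \<in> borel_measurable borel"
      "F ^^ n \<in> borel_measurable borel" for n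
    using assms by (simp_all add: borel_measurable_continuous_onI continuous_on_funpow)
  have m': "g \<in> measurable P borel" "F ^^ n \<in> measurable P borel" for n
    using m assms(2) by (simp_all cong: measurable_cong_sets)
  have "distr (distr P borel g) borel (G ^^ n) = distr (distr P borel (F ^^ n)) borel g" for n
    using m m' by (simp add: distr_distr comp)
  then show ?thesis
    using weakly_converges_continuous_image[OF _ assms(5)] assms(1)
    by (simp add: is_shift_probability_def)
qed

text \<open>Size-biasing gives childlessness the weight \<open>0 * p 0\<close>, and mean 1 makes the
  weights actual probabilities. A size-biased offspring is thus an arrangement of
  \<open>{..<k}\<close> with \<open>k > 0\<close> and contains the index \<open>0\<close>.\<close>

lemma spineI:
  assumes "1 \<in> S" "\<And>n. n \<in> S \<Longrightarrow> n + 1 \<in> S"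
    and "measure_pmf.expectation p real = 1"
    and "\<And>v. \<omega> v \<in> set_pmf (offspring (if fst v \<in> S \<and> snd v = [] then size_biased p else p))"
  shows "spine S \<omega>"
proof
  show "distinct (\<omega> v)" for v
    using assms(4)[of v] by (auto simp: set_pmf_offspring)
  show "0 \<in> set (\<omega> (n, []))" if "n \<in> S" for n
  proof -
    have "0 \<notin> set_pmf (size_biased p)"
      by (simp add: set_pmf_iff pmf_size_biased[OF assms(3)])
    then show ?thesis
      using assms(4)[of "(n, [])"] that by (auto simp: set_pmf_offspring intro: Nat.gr0I)
  qed
qed (use assms in auto)

lemma borel_measurable_PiM_pmf_tree_class:
  "(\<lambda>\<omega>. tree_class (spine_tree S \<omega>)) \<in> borel_measurable (\<Pi>\<^sub>M v\<in>UNIV. measure_pmf (A v))"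
proof (rule borel_measurable_tree_class_spine_tree)
  fix v
  have "(\<lambda>\<omega>. \<omega> v) \<in> measurable (\<Pi>\<^sub>M v\<in>UNIV. measure_pmf (A v)) (measure_pmf (A v))"
    by (rule measurable_component_singleton) simp
  then show "(\<lambda>\<omega>. \<omega> v) \<in> measurable (\<Pi>\<^sub>M v\<in>UNIV. measure_pmf (A v)) (count_space UNIV)"
    by simp
qed

text \<open>There are countably many coordinates, so the support conditions hold simultaneously off
  one null set. On that event all coupled trees satisfy the conditions of \<open>spine\<close> at
  once.\<close>

lemma AE_PiM_pmf:
  fixes A :: "'i::countable \<Rightarrow> 'a pmf"
  shows "AE x in (\<Pi>\<^sub>M v\<in>UNIV. measure_pmf (A v)). \<forall>v. x v \<in> set_pmf (A v)"
  unfolding AE_all_countable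
  by (intro allI AE_PiM_component) (simp_all add: measure_pmf.prob_space_axioms AE_measure_pmf)

lemma measurable_PiM_pmf_map:
  "(\<lambda>x v. g v (x (\<sigma> v))) \<in>
     measurable (\<Pi>\<^sub>M u\<in>UNIV. measure_pmf (A u)) (\<Pi>\<^sub>M v\<in>UNIV. measure_pmf (B v))"
proof (rule measurable_PiM_single')
  show "(\<lambda>x. g v (x (\<sigma> v))) \<in> measurable (\<Pi>\<^sub>M u\<in>UNIV. measure_pmf (A u)) (measure_pmf (B v))" for v
    by (rule measurable_compose[OF measurable_component_singleton[of "\<sigma> v"]]) simp_all
qed (simp add: PiE_def)

lemma reproduction_alt:
  "reproduction S p =
    (\<Pi>\<^sub>M v\<in>UNIV. measure_pmf (offspring (if fst v \<in> S \<and> snd v = [] then size_biased p else p)))"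
  unfolding reproduction_def by (rule arg_cong[where f = "PiM UNIV"]) (auto simp: fun_eq_iff)

section \<open>The coupling of all shifted trees with the Kesten tree\<close>

lemma is_shift_probability_EGWT:
  assumes mean: "measure_pmf.expectation p real = 1"
  shows "is_shift_probability ordered_parent_shift (EGWT p) (EKT p)"
proof -
  define off where
    "off S v = offspring (if fst v \<in> S \<and> snd v = [] then size_biased p else p)"
    for S :: "int set" and v :: label
  define C where "C v = pair_pmf (off UNIV v) (offspring p)" for v
  let ?Q = "\<Pi>\<^sub>M v\<in>UNIV. measure_pmf (C v)"
  have reproduction: "reproduction S p = (\<Pi>\<^sub>M v\<in>UNIV. measure_pmf (off S v))" for S
    by (simp add: reproduction_alt off_def)
  \<comment> \<open>The threshold \<open>1\<close> is that of \<open>EGWT\<close> before the root is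
    moved; \<open>n\<close> moves turn it into \<open>1 - n\<close>.\<close>
  define g :: "label \<Rightarrow> nat list \<times> nat list \<Rightarrow> nat list"
    where "g v = (if 1 \<le> fst v then fst else snd)" for v
  define \<omega> :: "nat \<Rightarrow> (label \<Rightarrow> nat list \<times> nat list) \<Rightarrow> label \<Rightarrow> nat list"
    \<comment> \<open>Reading \<open>x\<close> at the label displaced by \<open>- n\<close> cancels
      the recentring caused by \<open>n\<close> moves of the root, so that afterwards label
      \<open>v\<close> reads \<open>x v\<close> in every tree, as in the limit.\<close>
    where "\<omega> n x v = g v (x (shift_label (- int n) v))" for n x v
  define X where "X n x = (ordered_parent_shift ^^ n) (tree_class (spine_tree {1..} (\<omega> n x)))" for n x
  define Y where "Y x = tree_class (spine_tree UNIV (\<lambda>v. fst (x v)))"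
    for x :: "label \<Rightarrow> nat list \<times> nat list"
  have Q: "prob_space ?Q"
    by (intro prob_space_PiM measure_pmf.prob_space_axioms)
  \<comment> \<open>The offspring laws of the Kesten tree are invariant under translation along the
    path, so the displaced reading still has the law required at \<open>v\<close>.\<close>
  have off_shift: "off UNIV (shift_label k v) = off UNIV v" for k v
    by (simp add: off_def shift_label_def split: prod.splits)
  have law_g: "map_pmf (g v) (C (shift_label (- int n) v)) = off {1..} v" for n v
    by (simp add: g_def C_def off_shift map_fst_pair_pmf map_snd_pair_pmf) (simp add: off_def)
  have law_n: "distr ?Q (reproduction {1..} p) (\<omega> n) = reproduction {1..} p" for n
    unfolding reproduction \<omega>_def
    by (rule distr_PiM_pmf[where \<sigma> = "shift_label (- int n)" and g = g]) (rule inj_shift_label law_g)+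
  have law: "distr ?Q (reproduction UNIV p) (\<lambda>x v. fst (x v)) = reproduction UNIV p"
    unfolding reproduction
    by (rule distr_PiM_pmf[where \<sigma> = "\<lambda>v. v"]) (simp_all add: C_def map_fst_pair_pmf)
  have meas_n: "\<omega> n \<in> measurable ?Q (reproduction {1..} p)" for n
    unfolding \<omega>_def reproduction by (rule measurable_PiM_pmf_map)
  have meas: "(\<lambda>x v. fst (x v)) \<in> measurable ?Q (reproduction UNIV p)"
    unfolding reproduction by (rule measurable_PiM_pmf_map[where \<sigma> = "\<lambda>v. v"])
  have tree: "(\<lambda>\<omega>. tree_class (spine_tree S \<omega>)) \<in> borel_measurable (reproduction S p)" for S
    unfolding reproduction by (rule borel_measurable_PiM_pmf_tree_class)
  have F: "ordered_parent_shift ^^ n \<in> borel_measurable borel" for n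
    by (intro borel_measurable_continuous_onI continuous_on_funpow continuous_ordered_parent_shift)
  have X: "X n \<in> borel_measurable ?Q" for n
    unfolding X_def by (intro measurable_compose[OF _ F] measurable_compose[OF meas_n tree])
  have Y: "Y \<in> borel_measurable ?Q"
    unfolding Y_def by (rule measurable_compose[OF meas tree])
  have distr_X: "distr (EGWT p) borel (ordered_parent_shift ^^ n) = distr ?Q borel (X n)" for n
  proof -
    \<comment> \<open>For each \<open>n\<close> a different realisation of \<open>EGWT p\<close> is
      substituted, which is allowed because one law is shifted at a time.\<close>
    have "EGWT p = distr (distr ?Q (reproduction {1..} p) (\<omega> n)) borel
        (\<lambda>\<omega>. tree_class (spine_tree {1..} \<omega>))"
      unfolding law_n EGWT_def ..
    also have "\<dots> = distr ?Q borel (\<lambda>x. tree_class (spine_tree {1..} (\<omega> n x)))"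
      using meas_n tree by (simp add: distr_distr comp_def)
    finally show ?thesis
      using measurable_compose[OF meas_n tree] F by (simp add: distr_distr comp_def X_def[abs_def])
  qed
  have distr_Y: "EKT p = distr ?Q borel Y"
  proof -
    have "EKT p = distr (distr ?Q (reproduction UNIV p) (\<lambda>x v. fst (x v))) borel
        (\<lambda>\<omega>. tree_class (spine_tree UNIV \<omega>))"
      unfolding law EKT_def ..
    also have "\<dots> = distr ?Q borel Y"
      using meas tree by (simp add: distr_distr comp_def Y_def[abs_def])
    finally show ?thesis .
  qed
  have "AE x in ?Q. (\<lambda>n. X n x) \<longlonglongrightarrow> Y x"
    using AE_PiM_pmf[of C]
  proof eventually_elim
    case (elim x)
    have spine_Y: "spine UNIV (\<lambda>v. fst (x v))"
    proof (rule spineI[OF _ _ mean])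
      show "fst (x v) \<in> set_pmf (offspring (if fst v \<in> UNIV \<and> snd v = [] then size_biased p else p))"
        for v
        using elim[rule_format, of v] by (auto simp: C_def off_def)
    qed simp_all
    have spine_X: "spine {1..} (\<omega> n x)" for n
    proof (rule spineI[OF _ _ mean])
      show "\<omega> n x v \<in> set_pmf (offspring (if fst v \<in> {1..} \<and> snd v = [] then size_biased p else p))"
        for v
      proof -
        have "\<omega> n x v \<in> set_pmf (map_pmf (g v) (C (shift_label (- int n) v)))"
          unfolding \<omega>_def set_map_pmf by (rule imageI) (rule elim[rule_format])
        then show ?thesis unfolding law_g off_def .
      qed
    qed simp_all
    have X_eq: "X n x = tree_class (spine_tree {m. m + int n \<in> {1..}} (shift (int n) (\<omega> n x)))" for n
      unfolding X_def by (rule spine.ordered_parent_shift_spine_tree[OF spine_X])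
    \<comment> \<open>The strict inequality is what gives \<open>m + n \<ge> 1\<close> for all
      \<open>m \<ge> - r\<close>: every label that the \<open>r\<close>-ball can consult is then
      above the threshold and uses the Kesten component.\<close>
    have "same_ordered_ball r (Y x) (X n x)" if "r < n" for r n
      unfolding X_eq Y_def
    proof (rule same_ordered_ball_spine_tree[OF spine_Y spine.spine_shift[OF spine_X]])
      show "agree_above (- int r) UNIV (\<lambda>v. fst (x v))
          {m. m + int n \<in> {1..}} (shift (int n) (\<omega> n x))"
        unfolding agree_above_def split_paired_All
        using that by (simp add: shift_def \<omega>_def g_def shift_label_def)
    qed
    then have "\<forall>\<^sub>F n in sequentially. same_ordered_ball r (Y x) (X n x)" for r
      by (intro eventually_mono[OF eventually_gt_at_top[of r]])
    then show ?case
      by (simp add: tendsto_ordered_family_tree_class)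
  qed
  then show ?thesis
    unfolding is_shift_probability_def distr_X distr_Y
    by (rule weakly_converges_if_AE_tendsto[OF Q X Y])
qed

theorem proposition80:
  fixes p :: "nat pmf"
  assumes "measure_pmf.expectation p real = 1"
  shows "is_shift_probability ordered_parent_shift (EGWT p) (EKT p) \<and>
         is_shift_probability parent_shift (unordered (EGWT p)) (unordered (EKT p))"
proof
  show ordered: "is_shift_probability ordered_parent_shift (EGWT p) (EKT p)"
    by (rule is_shift_probability_EGWT[OF assms])
  show "is_shift_probability parent_shift (unordered (EGWT p)) (unordered (EKT p))"
    unfolding unordered_def
    by (rule is_shift_probability_continuous_image[OF ordered _ continuous_ordered_parent_shift
          continuous_parent_shift continuous_forget_order forget_order_ordered_parent_shift])
      (simp add: EGWT_def)
qed

end
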